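(* Let $r\ge1$ be an integer and $\delta\in[0,1/2]$. Then $$R^{(\mathrm{lin})}(r,\delta)\le\min_{0\le s<1/(r+1)}\Big\{sr+(1-s(r+1))\,R_0\Big(r,\frac{\delta}{1-s(r+1)}\Big)\Big\},$$ where $R_0(r,\delta):=h(\tau)-c(r+1,\tau)$, $c(w,\tau):=\frac{\log_2 e}{8w^2}\Big(\frac{\tau^w}{2}\Big)^{w+1}$, and $\tau:=\frac12-\sqrt{\delta(1-\delta)}$ (with $\delta$ in the definition of $\tau$ being the second argument of $R_0$).
   Context: A binary code $\mathcal{C}\subseteq\{0,1\}^n$ has locality $r$ if every coordinate $i\in[n]$ is contained in a subset $\mathcal{R}_i\subseteq[n]$ of size $r+1$ such that for some function $\phi_i:\{0,1\}^r\to\{0,1\}$, $c_i=\phi_i(c_{j_1},\dots,c_{j_r})$ for every codeword $c$, where $j_1<\dots<j_r$ are the elements of $\mathcal{R}_i\setminus\{i\}$. Let $M^{(\mathrm{lin})}(n,r,d)$ be the maximum cardinality of a binary linear code of length $n$, minimum Hamming distance $d$ and locality $r$, and $R^{(\mathrm{lin})}(r,\delta)=\limsup_{n\to\infty}\frac1n\log_2M^{(\mathrm{lin})}(n,r,\delta n)$. $h(x)=-x\log_2x-(1-x)\log_2(1-x)$ is the binary entropy function. *)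

theory Defs
  imports "HOL-Analysis.Analysis" "HOL-Library.Liminf_Limsup"
begin

definition words :: "nat \<Rightarrow> (nat \<Rightarrow> bool) set" where
  "words n = {c. \<forall>j\<ge>n. \<not> c j}"

definition hamming_dist :: "(nat \<Rightarrow> bool) \<Rightarrow> (nat \<Rightarrow> bool) \<Rightarrow> nat" where
  "hamming_dist c c' = card {j. c j \<noteq> c' j}"

definition binary_linear_code :: "nat \<Rightarrow> (nat \<Rightarrow> bool) set \<Rightarrow> bool" where
  "binary_linear_code n C \<longleftrightarrow> C \<subseteq> words n \<and> (\<lambda>_. False) \<in> C \<and>
     (\<forall>c\<in>C. \<forall>c'\<in>C. (\<lambda>j. c j \<noteq> c' j) \<in> C)"

definition min_dist_ge :: "(nat \<Rightarrow> bool) set \<Rightarrow> real \<Rightarrow> bool" where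
  "min_dist_ge C d \<longleftrightarrow> (\<forall>c\<in>C. \<forall>c'\<in>C. c \<noteq> c' \<longrightarrow> real (hamming_dist c c') \<ge> d)"

definition has_locality :: "nat \<Rightarrow> nat \<Rightarrow> (nat \<Rightarrow> bool) set \<Rightarrow> bool" where
  "has_locality n r C \<longleftrightarrow> (\<forall>i<n. \<exists>R (\<phi> :: bool list \<Rightarrow> bool). R \<subseteq> {0..<n} \<and> i \<in> R \<and> card R = r + 1 \<and>
      (\<forall>c\<in>C. c i = \<phi> (map c (sorted_list_of_set (R - {i})))))"

definition M_lin :: "nat \<Rightarrow> nat \<Rightarrow> real \<Rightarrow> nat" where
  "M_lin n r d = Max {card C | C. binary_linear_code n C \<and> min_dist_ge C d \<and> has_locality n r C}"

definition R_lin :: "nat \<Rightarrow> real \<Rightarrow> ereal" where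
  "R_lin r \<delta> = limsup (\<lambda>n. ereal (log 2 (real (M_lin n r (\<delta> * real n))) / real n))"

definition bin_entropy :: "real \<Rightarrow> real" where
  "bin_entropy x = - x * log 2 x - (1 - x) * log 2 (1 - x)"

definition c_const :: "nat \<Rightarrow> real \<Rightarrow> real" where
  "c_const w \<tau> = log 2 (exp 1) / (8 * real w ^ 2) * (\<tau> ^ w / 2) ^ (w + 1)"

definition R0 :: "nat \<Rightarrow> real \<Rightarrow> real" where
  "R0 r \<delta> = (let \<tau> = 1/2 - sqrt (\<delta> * (1 - \<delta>)) in bin_entropy \<tau> - c_const (r + 1) \<tau>)"

end

theory Submission
  imports Defs "HOL-Library.Nat_Bijection"
begin

text \<open>Identify words with sets of coordinates and call two words equivalent if they define the same
  character of the code \<open>C\<close>, i.e. if they lie in the same coset of the dual code; there are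
  \<open>|C|\<close> classes.  A function on a Hamming ball of radius \<open>t \<approx> \<tau>n\<close> that is almost an
  eigenfunction of the cube with eigenvalue exceeding \<open>n - 2d\<close> shows (Friedman--Tillich) that, up
  to a factor linear in \<open>n\<close>, all classes have a representative of weight at most \<open>t\<close>.

  To count these classes, choose in every class the leader of least weight, with ties broken by an
  additive order, and let \<open>G(\<theta>)\<close> be the generating function of leaders by weight.  Leaders form a
  downward closed family.  If \<open>i\<close> is the largest element of a dual word of weight at most
  \<open>w = r + 1\<close>, then there are many leaders \<open>x\<close> avoiding \<open>i\<close> for which \<open>x \<union> {i}\<close> is not a leader; the
  order can be chosen such that at least \<open>n/w\<close> coordinates \<open>i\<close> are of this kind.  This gives
  \<open>(1 + \<theta>) G'(\<theta>) \<le> n (1 - \<theta>^w / (2w^2)) G(\<theta>)\<close>, so \<open>G(\<theta>)\<close> is exponentially smaller than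
  \<open>(1 + \<theta>)^n\<close>, and the Chernoff choice \<open>\<theta> = \<tau> / (1 - \<tau>)\<close> yields the exponent
  \<open>h(\<tau>) - c(w, \<tau>)\<close>.  The parameter \<open>s\<close> comes from shortening the code on \<open>s n (r + 1)\<close>
  coordinates of rank at most \<open>s n r\<close>.\<close>

section \<open>The spectral bound\<close>

text \<open>Sets stand for vectors over GF(2), with \<open>sym_diff\<close> as addition; this is the
  Walsh character, -1 raised to the inner product of \<open>x\<close> and \<open>u\<close>.\<close>

definition chi :: "'a set \<Rightarrow> 'a set \<Rightarrow> real" where
  "chi x u = (-1) ^ card (x \<inter> u)"

lemma chi_commute: "chi x u = chi u x"
  by (simp add: chi_def Int_commute)

lemma chi_empty [simp]: "chi {} u = 1" "chi x {} = 1"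
  by (simp_all add: chi_def)

lemma chi_square [simp]: "chi x u * chi x u = 1"
  by (simp add: chi_def flip: power_mult_distrib)

lemma chi_eq_prod: "finite u \<Longrightarrow> chi x u = (\<Prod>j\<in>u. if j \<in> x then -1 else 1)"
  by (simp add: chi_def prod.If_cases Int_commute)

lemma chi_sym_diff_left: "finite u \<Longrightarrow> chi (sym_diff x y) u = chi x u * chi y u"
  by (simp add: chi_eq_prod flip: prod.distrib) (rule prod.cong, auto)

lemma chi_sym_diff_right: "finite x \<Longrightarrow> chi x (sym_diff u v) = chi x u * chi x v"
  by (metis chi_commute chi_sym_diff_left)

lemma chi_cases: "chi x u = 1 \<or> chi x u = -1"
  by (simp add: chi_def) (metis neg_one_even_power neg_one_odd_power)

lemma chi_singleton: "chi {i} u = (if i \<in> u then -1 else 1)"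
  by (auto simp: chi_def)

section \<open>Linear codes and cosets of the dual code\<close>

locale linear_code =
  fixes V :: "'a set" and C :: "'a set set"
  assumes finite_V: "finite V"
    and code_sub: "C \<subseteq> Pow V"
    and empty_in_code: "{} \<in> C"
    and sym_diff_in_code: "\<lbrakk>u \<in> C; v \<in> C\<rbrakk> \<Longrightarrow> sym_diff u v \<in> C"
begin

abbreviation n :: nat where "n \<equiv> card V"

text \<open>In particular \<open>eqv p {}\<close> says that \<open>p\<close> is itself a word of the
  dual code.\<close>

definition eqv :: "'a set \<Rightarrow> 'a set \<Rightarrow> bool" where
  "eqv x y \<longleftrightarrow> (\<forall>u\<in>C. chi x u = chi y u)"

lemma finite_code: "finite C"
  using finite_V code_sub by (meson finite_Pow_iff finite_subset)

lemma finite_codeword: "u \<in> C \<Longrightarrow> finite u"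
  using finite_V code_sub by (meson PowD finite_subset subsetD)

lemma eqv_refl [simp]: "eqv x x"
  by (simp add: eqv_def)

lemma eqv_sym: "eqv x y \<Longrightarrow> eqv y x"
  by (simp add: eqv_def)

lemma eqv_trans: "eqv x y \<Longrightarrow> eqv y z \<Longrightarrow> eqv x z"
  by (simp add: eqv_def)

lemma eqv_sym_diff: "eqv x y \<Longrightarrow> eqv x' y' \<Longrightarrow> eqv (sym_diff x x') (sym_diff y y')"
  using finite_codeword by (simp add: eqv_def chi_sym_diff_left)

text \<open>Orthogonality of characters on a subgroup: if a codeword \<open>v\<close> separates
  \<open>x\<close> from \<open>y\<close>, translating the sum by \<open>v\<close> multiplies it by
  -1, so it vanishes.\<close>

lemma sum_chi:
  assumes "x \<subseteq> V" "y \<subseteq> V"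
  shows "(\<Sum>u\<in>C. chi x u * chi y u) = (if eqv x y then real (card C) else 0)"
proof (cases "eqv x y")
  case True
  then have "(\<Sum>u\<in>C. chi x u * chi y u) = (\<Sum>u\<in>C. 1)"
    by (intro sum.cong) (simp_all add: eqv_def)
  then show ?thesis using True by simp
next
  case False
  then obtain v where v: "v \<in> C" "chi x v \<noteq> chi y v" by (auto simp: eqv_def)
  have fin: "finite x" "finite y" using assms finite_V by (auto intro: finite_subset)
  have neg: "chi x v * chi y v = -1" using v(2) chi_cases[of x v] chi_cases[of y v] by auto
  have bij: "bij_betw (\<lambda>u. sym_diff u v) C C"
    by (rule bij_betw_byWitness[where f' = "\<lambda>u. sym_diff u v"])
      (use v(1) sym_diff_in_code in auto)
  have "(\<Sum>u\<in>C. chi x u * chi y u) = (\<Sum>u\<in>C. chi x (sym_diff u v) * chi y (sym_diff u v))"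
    using sum.reindex_bij_betw[OF bij, of "\<lambda>u. chi x u * chi y u"] by simp
  also have "\<dots> = (\<Sum>u\<in>C. (chi x u * chi y u) * (chi x v * chi y v))"
    using fin by (intro sum.cong) (simp_all add: chi_sym_diff_right)
  also have "\<dots> = - (\<Sum>u\<in>C. chi x u * chi y u)"
    by (simp add: neg sum_negf)
  finally show ?thesis using False by simp
qed

text \<open>Characters are eigenfunctions of the adjacency operator of the cube: flipping
  \<open>i\<close> changes the sign exactly when \<open>i \<in> u\<close>.\<close>

lemma sum_chi_neighbours:
  assumes "u \<subseteq> V"
  shows "(\<Sum>i\<in>V. chi (sym_diff x {i}) u) = (real n - 2 * real (card u)) * chi x u"
proof -
  have fu: "finite u" using assms finite_V finite_subset by blast
  have "(\<Sum>i\<in>V. chi (sym_diff x {i}) u) = chi x u * (\<Sum>i\<in>V. if i \<in> u then -1 else 1)"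
    using fu by (simp add: chi_sym_diff_left chi_singleton sum_distrib_left)
  also have "(\<Sum>i\<in>V. if i \<in> u then -1 else 1 :: real) = real n - 2 * real (card u)"
  proof -
    have "V \<inter> u = u" "V \<inter> - u = V - u" using assms by auto
    moreover have "card (V - u) = n - card u" "card u \<le> n"
      using assms finite_V fu by (auto simp: card_Diff_subset intro: card_mono)
    ultimately show ?thesis
      using finite_V by (simp add: sum.If_cases of_nat_diff)
  qed
  finally show ?thesis by simp
qed

text \<open>A set of size k has k neighbours one level below and n - k one level above. At k = 0 the
  truncated \<open>card x - 1\<close> is harmless because its factor is 0.\<close>

lemma sum_radial_neighbours:
  fixes \<phi> :: "nat \<Rightarrow> real"
  assumes "x \<subseteq> V"
  shows "(\<Sum>i\<in>V. \<phi> (card (sym_diff x {i}))) =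
    real (card x) * \<phi> (card x - 1) + (real n - real (card x)) * \<phi> (card x + 1)"
proof -
  have fx: "finite x" using assms finite_V finite_subset by blast
  have "(\<Sum>i\<in>V. \<phi> (card (sym_diff x {i}))) =
      (\<Sum>i\<in>V. if i \<in> x then \<phi> (card x - 1) else \<phi> (card x + 1))"
  proof (rule sum.cong[OF refl])
    fix i
    have "sym_diff x {i} = (if i \<in> x then x - {i} else insert i x)" by auto
    then show "\<phi> (card (sym_diff x {i})) = (if i \<in> x then \<phi> (card x - 1) else \<phi> (card x + 1))"
      using fx by simp
  qed
  moreover have "V \<inter> x = x" "V \<inter> - x = V - x" using assms by auto
  moreover have "card (V - x) = n - card x" "card x \<le> n"
    using assms finite_V fx by (auto simp: card_Diff_subset intro: card_mono)
  ultimately show ?thesis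
    using finite_V by (simp add: sum.If_cases of_nat_diff)
qed

lemma bij_sym_diff: "v \<subseteq> V \<Longrightarrow> bij_betw (\<lambda>x. sym_diff x v) (Pow V) (Pow V)"
  by (rule bij_betw_byWitness[where f' = "\<lambda>u. sym_diff u v"]) auto

text \<open>Let \<open>g\<close> be the Fourier transform of the radial function \<open>f\<close>.
  Its second moment over \<open>C\<close> is bounded from below by Cauchy-Schwarz over the
  representatives in \<open>K\<close>, and from above by testing the eigenvalue inequality for
  \<open>f\<close> against the spectrum, where nonempty codewords have eigenvalue at most n -
  2d.\<close>

theorem spectral_bound:
  fixes \<phi> :: "nat \<Rightarrow> real" and lam d :: real
  assumes nonneg: "\<And>k. \<phi> k \<ge> 0"
    and supp: "\<And>k. k > t \<Longrightarrow> \<phi> k = 0"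
    and pos: "k0 \<le> n" "\<phi> k0 > 0"
    and eigen: "\<And>k. k \<le> n \<Longrightarrow> lam * \<phi> k \<le> real k * \<phi> (k - 1) + (real n - real k) * \<phi> (k + 1)"
    and dist: "\<And>u. u \<in> C \<Longrightarrow> u \<noteq> {} \<Longrightarrow> d \<le> real (card u)"
    and lam: "real n - 2 * d \<le> lam"
    and rep: "\<And>x. x \<subseteq> V \<Longrightarrow> card x \<le> t \<Longrightarrow> rep x \<in> K \<and> eqv x (rep x)"
    and K: "finite K"
  shows "real (card C) * (lam - (real n - 2 * d)) \<le> 2 * d * real (card K)"
proof -
  define f where "f x = \<phi> (card x)" for x :: "'a set"
  define P where "P = {x. x \<subseteq> V \<and> card x \<le> t}"
  define g where "g u = (\<Sum>x\<in>Pow V. f x * chi x u)" for u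
  define a where "a l = (\<Sum>x\<in>{x \<in> P. rep x = l}. f x)" for l
  have f0: "f x \<ge> 0" for x by (simp add: f_def nonneg)
  have finP: "finite P" using finite_V by (simp add: P_def)
  have finV: "finite (Pow V)" using finite_V by simp
  have sum_P: "(\<Sum>x\<in>Pow V. f x * h x) = (\<Sum>x\<in>P. f x * h x)" for h :: "'a set \<Rightarrow> real"
    by (rule sum.mono_neutral_right[OF finV])
      (auto simp: P_def f_def supp not_le)
  have g_P: "g u = (\<Sum>x\<in>P. f x * chi x u)" for u
    unfolding g_def by (rule sum_P)
  have g0: "g {} = (\<Sum>x\<in>P. f x)" by (simp add: g_P)
  have g0_pos: "g {} > 0"
  proof -
    obtain x where x: "x \<subseteq> V" "card x = k0" using obtain_subset_with_card_n[OF pos(1)] by metis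
    have "0 < f x" using x pos by (simp add: f_def)
    also have "\<dots> \<le> (\<Sum>x\<in>Pow V. f x)"
      using x finV f0 by (intro member_le_sum) auto
    finally show ?thesis by (simp add: g_def)
  qed
  \<comment> \<open>Parseval on \<open>C\<close>: after expanding the squares, summing the
    characters leaves only pairs in the same coset.\<close>
  have sq: "(\<Sum>u\<in>C. (g u)\<^sup>2) = (\<Sum>x\<in>P. \<Sum>y\<in>P. f x * f y * (if eqv x y then real (card C) else 0))"
  proof -
    have "(\<Sum>u\<in>C. (g u)\<^sup>2) = (\<Sum>u\<in>C. \<Sum>x\<in>P. \<Sum>y\<in>P. f x * f y * (chi x u * chi y u))"
      by (simp add: g_P power2_eq_square sum_product algebra_simps)
    also have "\<dots> = (\<Sum>x\<in>P. \<Sum>u\<in>C. \<Sum>y\<in>P. f x * f y * (chi x u * chi y u))"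
      by (rule sum.swap)
    also have "\<dots> = (\<Sum>x\<in>P. \<Sum>y\<in>P. \<Sum>u\<in>C. f x * f y * (chi x u * chi y u))"
      by (rule sum.cong[OF refl], rule sum.swap)
    also have "\<dots> = (\<Sum>x\<in>P. \<Sum>y\<in>P. f x * f y * (\<Sum>u\<in>C. chi x u * chi y u))"
      by (simp add: sum_distrib_left)
    also have "\<dots> = (\<Sum>x\<in>P. \<Sum>y\<in>P. f x * f y * (if eqv x y then real (card C) else 0))"
      by (intro sum.cong refl) (simp add: sum_chi P_def)
    finally show ?thesis .
  qed
  have repK: "rep ` P \<subseteq> K" using rep by (auto simp: P_def)
  \<comment> \<open>Points with a common representative are equivalent, so the pairs counted by the
    squares of the \<open>a l\<close> are among those counted in \<open>sq\<close>.\<close>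
  have low: "real (card C) * (\<Sum>l\<in>K. (a l)\<^sup>2) \<le> (\<Sum>u\<in>C. (g u)\<^sup>2)"
  proof -
    have "(\<Sum>l\<in>K. (a l)\<^sup>2) = (\<Sum>l\<in>K. \<Sum>x\<in>{x \<in> P. rep x = l}. f x * a (rep x))"
    proof (rule sum.cong[OF refl])
      fix l
      have "(\<Sum>x\<in>{x \<in> P. rep x = l}. f x * a (rep x)) = (\<Sum>x\<in>{x \<in> P. rep x = l}. f x * a l)"
        by (rule sum.cong) auto
      then show "(a l)\<^sup>2 = (\<Sum>x\<in>{x \<in> P. rep x = l}. f x * a (rep x))"
        by (simp add: a_def power2_eq_square sum_distrib_right)
    qed
    also have "\<dots> = (\<Sum>x\<in>P. f x * a (rep x))"
      using sum.group[OF finP K repK, of "\<lambda>x. f x * a (rep x)"] .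
    also have "\<dots> = (\<Sum>x\<in>P. \<Sum>y\<in>P. f x * f y * (if rep y = rep x then 1 else 0))"
      unfolding a_def sum.inter_filter[OF finP] sum_distrib_left
      by (intro sum.cong refl) auto
    finally have E: "(\<Sum>l\<in>K. (a l)\<^sup>2) =
        (\<Sum>x\<in>P. \<Sum>y\<in>P. f x * f y * (if rep y = rep x then 1 else 0))" .
    have "real (card C) * (\<Sum>l\<in>K. (a l)\<^sup>2) =
        (\<Sum>x\<in>P. \<Sum>y\<in>P. f x * f y * (if rep y = rep x then real (card C) else 0))"
      unfolding E sum_distrib_left by (intro sum.cong refl) auto
    also have "\<dots> \<le> (\<Sum>x\<in>P. \<Sum>y\<in>P. f x * f y * (if eqv x y then real (card C) else 0))"
    proof (intro sum_mono mult_left_mono)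
      fix x y assume "x \<in> P" "y \<in> P"
      then have "rep y = rep x \<Longrightarrow> eqv x y"
        using rep by (metis (mono_tags, lifting) P_def eqv_sym eqv_trans mem_Collect_eq)
      then show "(if rep y = rep x then real (card C) else 0) \<le> (if eqv x y then real (card C) else 0)"
        by auto
    qed (simp add: f0)
    finally show ?thesis by (simp add: sq)
  qed
  have "g {} = (\<Sum>l\<in>K. a l)"
    unfolding g0 a_def using sum.group[OF finP K repK, of f] by simp
  then have "(g {})\<^sup>2 \<le> (\<Sum>l\<in>K. (a l)\<^sup>2) * real (card K)"
    using sum_squared_le_sum_of_squares[of a K] by simp
  then have cs: "real (card C) * (g {})\<^sup>2 \<le> (\<Sum>u\<in>C. (g u)\<^sup>2) * real (card K)"
    using low by (smt (verit) mult.assoc mult_left_mono mult_right_mono of_nat_0_le_iff)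
  \<comment> \<open>The adjacency operator is self-adjoint, so it can be moved from the character
    onto \<open>f\<close>.\<close>
  have adj: "(real n - 2 * real (card u)) * g u =
      (\<Sum>x\<in>Pow V. (\<Sum>i\<in>V. f (sym_diff x {i})) * chi x u)" if "u \<in> C" for u
  proof -
    have "(real n - 2 * real (card u)) * g u = (\<Sum>x\<in>Pow V. f x * (\<Sum>i\<in>V. chi (sym_diff x {i}) u))"
    proof -
      have "u \<subseteq> V" using that code_sub by auto
      show ?thesis
        unfolding g_def sum_chi_neighbours[OF \<open>u \<subseteq> V\<close>] sum_distrib_left[of _ _ "Pow V"]
        by (intro sum.cong refl) (simp only: mult_ac)
    qed
    also have "\<dots> = (\<Sum>i\<in>V. \<Sum>x\<in>Pow V. f x * chi (sym_diff x {i}) u)"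
      by (simp add: sum_distrib_left sum.swap[of _ _ V])
    also have "\<dots> = (\<Sum>i\<in>V. \<Sum>x\<in>Pow V. f (sym_diff x {i}) * chi x u)"
    proof (rule sum.cong[OF refl])
      fix i assume "i \<in> V"
      then have "{i} \<subseteq> V" by simp
      have inv: "sym_diff (sym_diff x {i}) {i} = x" for x by auto
      show "(\<Sum>x\<in>Pow V. f x * chi (sym_diff x {i}) u) = (\<Sum>x\<in>Pow V. f (sym_diff x {i}) * chi x u)"
        using sum.reindex_bij_betw[OF bij_sym_diff[OF \<open>{i} \<subseteq> V\<close>], of "\<lambda>x. f x * chi (sym_diff x {i}) u"]
        by (simp only: inv)
    qed
    also have "\<dots> = (\<Sum>x\<in>Pow V. (\<Sum>i\<in>V. f (sym_diff x {i})) * chi x u)"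
      by (simp add: sum_distrib_right sum.swap[of _ V])
    finally show ?thesis .
  qed
  \<comment> \<open>Both \<open>f\<close> and the defect \<open>e\<close> of the eigenvalue
    inequality are pointwise nonnegative, and by orthogonality the sum is a nonnegative combination
    of the products \<open>e x * f y\<close>.\<close>
  have "0 \<le> (\<Sum>u\<in>C. (real n - 2 * real (card u) - lam) * (g u)\<^sup>2)"
  proof -
    define e where "e x = (\<Sum>i\<in>V. f (sym_diff x {i})) - lam * f x" for x
    have e0: "e x \<ge> 0" if "x \<in> Pow V" for x
    proof -
      have "card x \<le> n" using that finite_V by (auto intro: card_mono)
      then show ?thesis
        using eigen[of "card x"] sum_radial_neighbours[of x \<phi>] that by (simp add: e_def f_def)
    qed
    have "(\<Sum>u\<in>C. (real n - 2 * real (card u) - lam) * (g u)\<^sup>2) =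
        (\<Sum>u\<in>C. (\<Sum>x\<in>Pow V. e x * chi x u) * (\<Sum>y\<in>Pow V. f y * chi y u))"
    proof (rule sum.cong[OF refl])
      fix u assume u: "u \<in> C"
      have "(\<Sum>x\<in>Pow V. e x * chi x u) =
          (\<Sum>x\<in>Pow V. (\<Sum>i\<in>V. f (sym_diff x {i})) * chi x u) - lam * (\<Sum>x\<in>Pow V. f x * chi x u)"
        unfolding e_def left_diff_distrib sum_subtractf sum_distrib_left[of lam] by (simp only: mult.assoc)
      then have eg: "(\<Sum>x\<in>Pow V. e x * chi x u) = (real n - 2 * real (card u)) * g u - lam * g u"
        unfolding adj[OF u, symmetric] g_def[symmetric] .
      show "(real n - 2 * real (card u) - lam) * (g u)\<^sup>2 =
          (\<Sum>x\<in>Pow V. e x * chi x u) * (\<Sum>y\<in>Pow V. f y * chi y u)"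
        unfolding eg g_def[symmetric] by (simp add: power2_eq_square algebra_simps)
    qed
    also have "\<dots> = (\<Sum>u\<in>C. \<Sum>x\<in>Pow V. \<Sum>y\<in>Pow V. e x * f y * (chi x u * chi y u))"
      by (simp add: sum_product algebra_simps)
    also have "\<dots> = (\<Sum>x\<in>Pow V. \<Sum>u\<in>C. \<Sum>y\<in>Pow V. e x * f y * (chi x u * chi y u))"
      by (rule sum.swap)
    also have "\<dots> = (\<Sum>x\<in>Pow V. \<Sum>y\<in>Pow V. \<Sum>u\<in>C. e x * f y * (chi x u * chi y u))"
      by (rule sum.cong[OF refl], rule sum.swap)
    also have "\<dots> = (\<Sum>x\<in>Pow V. \<Sum>y\<in>Pow V. e x * f y * (\<Sum>u\<in>C. chi x u * chi y u))"
      by (simp add: sum_distrib_left)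
    also have "\<dots> = (\<Sum>x\<in>Pow V. \<Sum>y\<in>Pow V. e x * f y * (if eqv x y then real (card C) else 0))"
      by (intro sum.cong refl) (simp add: sum_chi)
    also have "\<dots> \<ge> 0"
      by (intro sum_nonneg mult_nonneg_nonneg e0 f0) auto
    finally show ?thesis .
  qed
  \<comment> \<open>For \<open>u = {}\<close> the exact coefficient is \<open>n - lam\<close>; its
    surplus of 2d over the common coefficient is kept as a separate term.\<close>
  also have "\<dots> \<le> (\<Sum>u\<in>C. (real n - 2 * d - lam) * (g u)\<^sup>2 + (if u = {} then 2 * d * (g {})\<^sup>2 else 0))"
  proof (rule sum_mono)
    fix u assume u: "u \<in> C"
    show "(real n - 2 * real (card u) - lam) * (g u)\<^sup>2
        \<le> (real n - 2 * d - lam) * (g u)\<^sup>2 + (if u = {} then 2 * d * (g {})\<^sup>2 else 0)"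
    proof (cases "u = {}")
      case False
      then show ?thesis using dist[OF u] by (simp add: mult_right_mono)
    qed (simp add: algebra_simps)
  qed
  also have "\<dots> = (real n - 2 * d - lam) * (\<Sum>u\<in>C. (g u)\<^sup>2) + 2 * d * (g {})\<^sup>2"
    using finite_code empty_in_code by (simp add: sum.distrib sum_distrib_left)
  finally have up: "(lam - (real n - 2 * d)) * (\<Sum>u\<in>C. (g u)\<^sup>2) \<le> 2 * d * (g {})\<^sup>2"
    by (simp add: algebra_simps)
  have "real (card C) * (lam - (real n - 2 * d)) * (g {})\<^sup>2
      \<le> (lam - (real n - 2 * d)) * ((\<Sum>u\<in>C. (g u)\<^sup>2) * real (card K))"
    using mult_left_mono[OF cs, of "lam - (real n - 2 * d)"] lam by (simp add: algebra_simps)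
  also have "\<dots> \<le> 2 * d * (g {})\<^sup>2 * real (card K)"
    using mult_right_mono[OF up, of "real (card K)"] by (simp add: algebra_simps)
  finally have "real (card C) * (lam - (real n - 2 * d)) * (g {})\<^sup>2 \<le> 2 * d * real (card K) * (g {})\<^sup>2"
    by (simp add: algebra_simps)
  then show ?thesis using g0_pos by simp
qed

end

section \<open>Coset leaders and their generating function\<close>

text \<open>Injectivity makes the lightest member of each coset unique, and monotonicity makes it
  one of least cardinality. A weight that is a sum over elements permits exchange arguments.\<close>

locale leader_order = linear_code +
  fixes \<omega> :: "'a \<Rightarrow> nat"
  assumes sum_weight_inj: "inj_on (sum \<omega>) (Pow V)"
    and sum_weight_mono: "\<lbrakk>x \<subseteq> V; y \<subseteq> V; card x < card y\<rbrakk> \<Longrightarrow> sum \<omega> x < sum \<omega> y"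
begin

definition leaders :: "'a set set" where
  "leaders = {x \<in> Pow V. \<forall>y\<in>Pow V. eqv x y \<longrightarrow> sum \<omega> x \<le> sum \<omega> y}"

definition leader :: "'a set \<Rightarrow> 'a set" where
  "leader x = (SOME l. l \<in> leaders \<and> eqv x l)"

lemma leaders_sub: "x \<in> leaders \<Longrightarrow> x \<subseteq> V"
  by (simp add: leaders_def)

lemma finite_leaders: "finite leaders"
  using finite_V by (simp add: leaders_def)

lemma finite_leader: "x \<in> leaders \<Longrightarrow> finite x"
  using leaders_sub finite_V finite_subset by blast

lemma leaders_min: "\<lbrakk>x \<in> leaders; y \<subseteq> V; eqv x y\<rbrakk> \<Longrightarrow> sum \<omega> x \<le> sum \<omega> y"
  by (simp add: leaders_def)

lemma leader:
  assumes "x \<subseteq> V"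
  shows "leader x \<in> leaders" "eqv x (leader x)"
proof -
  define S where "S = {y. y \<subseteq> V \<and> eqv x y}"
  have "x \<in> S" using assms by (simp add: S_def)
  then have l: "arg_min (sum \<omega>) (\<lambda>y. y \<in> S) \<in> S"
    and m: "\<And>y. y \<in> S \<Longrightarrow> sum \<omega> (arg_min (sum \<omega>) (\<lambda>y. y \<in> S)) \<le> sum \<omega> y"
    by (auto intro: arg_min_natI arg_min_nat_le)
  have "arg_min (sum \<omega>) (\<lambda>y. y \<in> S) \<in> leaders \<and> eqv x (arg_min (sum \<omega>) (\<lambda>y. y \<in> S))"
    using l m eqv_trans unfolding leaders_def S_def by blast
  then have "leader x \<in> leaders \<and> eqv x (leader x)"
    unfolding leader_def by (rule someI)
  then show "leader x \<in> leaders" "eqv x (leader x)" by auto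
qed

lemma leaders_eqv_eq:
  assumes "x \<in> leaders" "y \<in> leaders" "eqv x y"
  shows "x = y"
proof -
  have "sum \<omega> x = sum \<omega> y"
    using leaders_min[OF assms(1) leaders_sub[OF assms(2)] assms(3)]
      leaders_min[OF assms(2) leaders_sub[OF assms(1)] eqv_sym[OF assms(3)]] by simp
  then show ?thesis
    using sum_weight_inj assms(1,2) leaders_sub by (meson PowI inj_onD)
qed

lemma leader_eq: "\<lbrakk>x \<subseteq> V; l \<in> leaders; eqv x l\<rbrakk> \<Longrightarrow> leader x = l"
  using leaders_eqv_eq[OF leader(1)] eqv_trans[OF eqv_sym[OF leader(2)]] by blast

lemma card_leader_le:
  assumes "x \<subseteq> V"
  shows "card (leader x) \<le> card x"
  using leaders_min[OF leader(1) assms eqv_sym[OF leader(2)], OF assms assms]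
    sum_weight_mono[OF assms leaders_sub[OF leader(1)[OF assms]]]
  by linarith

lemma empty_leader: "{} \<in> leaders"
  by (simp add: leaders_def)

text \<open>By additivity of the weight: if \<open>y\<close> were a lighter equivalent of
  \<open>x - {i}\<close>, then \<open>sym_diff y {i}\<close> would be a lighter equivalent of
  \<open>x\<close>.\<close>

lemma leaders_remove:
  assumes x: "x \<in> leaders" and i: "i \<in> x"
  shows "x - {i} \<in> leaders"
proof -
  have "sum \<omega> (x - {i}) \<le> sum \<omega> y" if y: "y \<subseteq> V" "eqv (x - {i}) y" for y
  proof -
    have "sym_diff (x - {i}) {i} = x" using i by auto
    then have e: "eqv x (sym_diff y {i})" using eqv_sym_diff[OF y(2) eqv_refl[of "{i}"]] by simp
    have iV: "i \<in> V" using i leaders_sub[OF x] by auto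
    have le: "sum \<omega> x \<le> sum \<omega> (sym_diff y {i})"
      using leaders_min[OF x _ e] y(1) iV by auto
    have sx: "sum \<omega> x = \<omega> i + sum \<omega> (x - {i})"
      using i finite_leader[OF x] by (simp add: sum.remove)
    have fy: "finite y" using y(1) finite_V finite_subset by blast
    show ?thesis
    proof (cases "i \<in> y")
      case True
      then have "sym_diff y {i} = y - {i}" by auto
      moreover have "sum \<omega> (y - {i}) \<le> sum \<omega> y" using fy by (simp add: sum_mono2)
      ultimately show ?thesis using le sx by simp
    next
      case False
      then have "sym_diff y {i} = insert i y" by auto
      then show ?thesis using le sx False fy by simp
    qed
  qed
  then show ?thesis using leaders_sub[OF x] by (auto simp: leaders_def)
qed

text \<open>If \<open>s\<close> lies in \<open>a\<close> or \<open>b\<close>, downward closure makes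
  the two leaders differ by \<open>s\<close> alone, contradicting \<open>i\<close>. Otherwise
  minimality of \<open>b\<close> against \<open>insert s a\<close> and of \<open>insert i a\<close>
  against \<open>insert s (b - {i})\<close> add up to
  \<open>\<omega> i \<le> \<omega> s\<close>.\<close>

lemma leader_switch:
  assumes a: "a \<in> leaders" and b: "b \<in> leaders" and e: "eqv b (sym_diff a {s})"
    and s: "s \<in> V" "\<omega> s < \<omega> i" and i: "i \<notin> a" "i \<in> b"
  shows "insert i a \<notin> leaders"
proof
  assume ai: "insert i a \<in> leaders"
  have "i \<noteq> s" using s by auto
  have "sym_diff (sym_diff a {s}) {s} = a" by auto
  then have e': "eqv (sym_diff b {s}) a" using eqv_sym_diff[OF e eqv_refl[of "{s}"]] by simp
  consider "s \<in> a" | "s \<in> b" | "s \<notin> a" "s \<notin> b" by auto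
  then show False
  proof cases
    case 1
    then have "sym_diff a {s} = a - {s}" by auto
    then have "b = a - {s}" using leaders_eqv_eq[OF b leaders_remove[OF a 1]] e by simp
    then show False using i by auto
  next
    case 2
    then have "sym_diff b {s} = b - {s}" by auto
    then have "b - {s} = a" using leaders_eqv_eq[OF leaders_remove[OF b 2] a] e' by simp
    then show False using i \<open>i \<noteq> s\<close> by auto
  next
    case 3
    have fin: "finite a" "finite b" using a b finite_leader by auto
    have "sum \<omega> b \<le> sum \<omega> (sym_diff a {s})"
      by (rule leaders_min[OF b _ e]) (use leaders_sub[OF a] s in auto)
    moreover have "sym_diff a {s} = insert s a" using 3 by auto
    ultimately have le1: "sum \<omega> b \<le> \<omega> s + sum \<omega> a" using 3 fin by simp
    have "eqv (sym_diff a {i}) (sym_diff (sym_diff b {s}) {i})"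
      by (rule eqv_sym_diff[OF eqv_sym[OF e'] eqv_refl])
    moreover have "sym_diff a {i} = insert i a" "sym_diff (sym_diff b {s}) {i} = insert s (b - {i})"
      using 3 i \<open>i \<noteq> s\<close> by auto
    ultimately have "eqv (insert i a) (insert s (b - {i}))" by simp
    then have "sum \<omega> (insert i a) \<le> sum \<omega> (insert s (b - {i}))"
      by (rule leaders_min[OF ai, rotated]) (use leaders_sub[OF b] s in auto)
    moreover have "sum \<omega> b = \<omega> i + sum \<omega> (b - {i})" using fin i by (simp add: sum.remove)
    ultimately have "2 * \<omega> i \<le> 2 * \<omega> s" using le1 3 fin i by simp
    then show False using s by simp
  qed
qed

section \<open>Generating functions of leaders\<close>

definition up :: "'a \<Rightarrow> 'a set set" where
  "up i = {x \<in> leaders. i \<notin> x \<and> insert i x \<in> leaders}"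

definition bad :: "'a \<Rightarrow> 'a set set" where
  "bad i = {x \<in> leaders. i \<notin> x \<and> insert i x \<notin> leaders}"

definition gf :: "'a set set \<Rightarrow> real \<Rightarrow> real" where
  "gf X \<theta> = (\<Sum>x\<in>X. \<theta> ^ card x)"

lemma finite_up: "finite (up i)" and finite_bad: "finite (bad i)"
  using finite_leaders by (auto simp: up_def bad_def)

lemma gf_nonneg: "\<theta> \<ge> 0 \<Longrightarrow> gf X \<theta> \<ge> 0"
  by (simp add: gf_def sum_nonneg)

lemma gf_UN_le:
  assumes "\<theta> \<ge> 0" and fin: "\<And>k. finite (X k)"
  shows "gf (\<Union>k<(m::nat). X k) \<theta> \<le> (\<Sum>k<m. gf (X k) \<theta>)"
proof (induction m)
  case (Suc m)
  have "gf (\<Union>k<Suc m. X k) \<theta> = gf (X m \<union> (\<Union>k<m. X k)) \<theta>"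
    by (simp add: lessThan_Suc)
  also have "\<dots> \<le> gf (X m) \<theta> + gf (\<Union>k<m. X k) \<theta>"
    using fin \<open>\<theta> \<ge> 0\<close> by (simp add: gf_def sum_Un sum_nonneg)
  finally show ?case using Suc by simp
qed (simp add: gf_def)

text \<open>Downward closure makes insertion of \<open>i\<close> a bijection from
  \<open>up i\<close> onto the leaders containing \<open>i\<close>, and every size grows by
  one.\<close>

lemma gf_containing: "gf {x \<in> leaders. i \<in> x} \<theta> = \<theta> * gf (up i) \<theta>"
proof -
  have bij: "bij_betw (insert i) (up i) {x \<in> leaders. i \<in> x}"
  proof (rule bij_betw_byWitness[where f' = "\<lambda>x. x - {i}"])
    show "(\<lambda>x. x - {i}) ` {x \<in> leaders. i \<in> x} \<subseteq> up i"
    proof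
      fix z assume "z \<in> (\<lambda>x. x - {i}) ` {x \<in> leaders. i \<in> x}"
      then obtain x where "x \<in> leaders" "i \<in> x" "z = x - {i}" by blast
      then show "z \<in> up i"
        using leaders_remove[of x i] by (simp add: up_def insert_absorb)
    qed
  qed (auto simp: up_def)
  have "gf {x \<in> leaders. i \<in> x} \<theta> = (\<Sum>x\<in>up i. \<theta> ^ card (insert i x))"
    unfolding gf_def by (rule sum.reindex_bij_betw[OF bij, symmetric])
  also have "\<dots> = (\<Sum>x\<in>up i. \<theta> * \<theta> ^ card x)"
    using finite_leader by (intro sum.cong refl) (auto simp: up_def)
  finally show ?thesis by (simp add: gf_def sum_distrib_left)
qed

lemma gf_split: "gf leaders \<theta> = (1 + \<theta>) * gf (up i) \<theta> + gf (bad i) \<theta>"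
proof -
  have "leaders = {x \<in> leaders. i \<in> x} \<union> (up i \<union> bad i)"
    by (auto simp: up_def bad_def)
  then have "gf leaders \<theta> = gf ({x \<in> leaders. i \<in> x} \<union> (up i \<union> bad i)) \<theta>" by simp
  also have "\<dots> = gf {x \<in> leaders. i \<in> x} \<theta> + gf (up i \<union> bad i) \<theta>"
    unfolding gf_def
    by (rule sum.union_disjoint) (use finite_leaders finite_up finite_bad in \<open>auto simp: up_def bad_def\<close>)
  also have "gf (up i \<union> bad i) \<theta> = gf (up i) \<theta> + gf (bad i) \<theta>"
    unfolding gf_def
    by (rule sum.union_disjoint) (use finite_up finite_bad in \<open>auto simp: up_def bad_def\<close>)
  finally show ?thesis by (simp add: gf_containing algebra_simps)
qed

text \<open>Going from \<open>x\<close> to \<open>x \<union> {i}\<close> along the elements of a dual word \<open>p\<close> other than \<open>i\<close>, the leader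
  acquires \<open>i\<close> at some step; by the lemma \<open>leader_switch\<close> the leader before that step lies in \<open>bad i\<close>.\<close>

lemma up_le_bad:
  assumes p: "p \<subseteq> V" "i \<in> p" "eqv p {}"
    and max: "\<And>j. j \<in> p - {i} \<Longrightarrow> \<omega> j < \<omega> i"
    and \<theta>: "0 \<le> \<theta>" "\<theta> \<le> 1"
  shows "\<theta> ^ (card p - 1) * gf (up i) \<theta> \<le> real (card p - 1) * gf (bad i) \<theta>"
proof -
  have fp: "finite p" using p(1) finite_V finite_subset by blast
  define m where "m = card p - 1"
  have cm: "card (p - {i}) = m" using p fp by (simp add: m_def)
  \<comment> \<open>An enumeration of \<open>p - {i}\<close>: \<open>T k\<close> will collect its
    first \<open>k\<close> elements, and \<open>y x k\<close> will be the leader reached from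
    \<open>x\<close> after adding them.\<close>
  obtain s where s: "bij_betw s {0..<m} (p - {i})"
    using ex_bij_betw_nat_finite[of "p - {i}"] fp cm by auto
  define T where "T k = s ` {0..<k}" for k
  have TV: "T k \<subseteq> V" if "k \<le> m" for k
  proof -
    have "T k \<subseteq> s ` {0..<m}" using that by (auto simp: T_def)
    then show ?thesis using s p(1) by (auto simp: bij_betw_def)
  qed
  have cT: "card (T k) \<le> k" for k
    unfolding T_def using card_image_le[of "{0..<k}" s] by simp
  have T_Suc: "T (Suc k) = sym_diff (T k) {s k}" if "k < m" for k
  proof -
    have "inj_on s {0..<m}" using s by (simp add: bij_betw_def)
    then have "s k \<notin> T k" using that inj_onD[of s "{0..<m}" k] by (fastforce simp: T_def)
    moreover have "T (Suc k) = insert (s k) (T k)" by (auto simp: T_def atLeast0_lessThan_Suc)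
    ultimately show ?thesis by auto
  qed
  define y where "y x k = leader (sym_diff x (T k))" for x k
  have sub: "sym_diff x (T k) \<subseteq> V" if "x \<in> leaders" "k \<le> m" for x k
    using that leaders_sub TV by blast
  have y_leader: "y x k \<in> leaders" "eqv (sym_diff x (T k)) (y x k)" if "x \<in> leaders" "k \<le> m" for x k
    using leader[OF sub[OF that]] by (simp_all add: y_def)
  \<comment> \<open>The walk starts at \<open>x\<close>, without \<open>i\<close>, and ends at
    \<open>insert i x\<close>, since modulo the dual word \<open>p\<close> adding
    \<open>p - {i}\<close> amounts to adding \<open>{i}\<close>. Hence \<open>i\<close> enters at
    some step \<open>k\<close>.\<close>
  have up_sub: "up i \<subseteq> (\<Union>k<m. {x \<in> leaders. y x k \<in> bad i})"
  proof
    fix x assume x: "x \<in> up i"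
    then have xl: "x \<in> leaders" "i \<notin> x" "insert i x \<in> leaders" by (auto simp: up_def)
    have "y x 0 = x"
      using leader_eq[OF leaders_sub[OF xl(1)] xl(1)] by (simp add: y_def T_def)
    moreover have "y x m = insert i x"
    proof -
      have "T m = p - {i}" using s by (simp add: T_def bij_betw_def)
      have "eqv (sym_diff (sym_diff x {i}) p) (sym_diff (sym_diff x {i}) {})"
        by (rule eqv_sym_diff[OF eqv_refl p(3)])
      moreover have "sym_diff (sym_diff x {i}) p = sym_diff x (p - {i})" using p(2) by auto
      moreover have "sym_diff (sym_diff x {i}) {} = insert i x" using xl(2) by auto
      ultimately have "eqv (sym_diff x (T m)) (insert i x)" using \<open>T m = p - {i}\<close> by simp
      then show ?thesis unfolding y_def
        by (rule leader_eq[OF sub[OF xl(1) order_refl] xl(3)])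
    qed
    moreover have "i \<notin> y x k" if "\<forall>k<m. i \<notin> y x k \<longrightarrow> i \<notin> y x (Suc k)" "i \<notin> y x 0" "k \<le> m" for k
      using that(3) by (induction k) (use that(1,2) in auto)
    ultimately have "\<exists>k<m. i \<notin> y x k \<and> i \<in> y x (Suc k)"
      using xl(2) by (metis insertI1 order_refl)
    then obtain k where k: "k < m" "i \<notin> y x k" "i \<in> y x (Suc k)" by auto
    have sk: "s k \<in> p - {i}" using s k(1) by (auto simp: bij_betw_def)
    have "eqv (y x (Suc k)) (sym_diff x (T (Suc k)))"
      using y_leader[OF xl(1), of "Suc k"] k(1) by (simp add: eqv_sym)
    also have "sym_diff x (T (Suc k)) = sym_diff (sym_diff x (T k)) {s k}"
      unfolding T_Suc[OF k(1)] by auto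
    finally have "eqv (y x (Suc k)) (sym_diff (sym_diff x (T k)) {s k})" .
    moreover have "eqv (sym_diff (sym_diff x (T k)) {s k}) (sym_diff (y x k) {s k})"
      by (rule eqv_sym_diff[OF y_leader(2)[OF xl(1)] eqv_refl]) (use k(1) in simp)
    ultimately have e: "eqv (y x (Suc k)) (sym_diff (y x k) {s k})" by (rule eqv_trans)
    have "insert i (y x k) \<notin> leaders"
      by (rule leader_switch[OF _ _ e _ _ k(2,3)])
        (use y_leader(1)[OF xl(1)] sk p(1) k(1) max in auto)
    then show "x \<in> (\<Union>k<m. {x \<in> leaders. y x k \<in> bad i})"
      using k xl y_leader(1)[OF xl(1), of k] by (auto simp: bad_def)
  qed
  \<comment> \<open>For fixed \<open>k\<close> the translation by \<open>T k\<close> can be undone,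
    so distinct \<open>x\<close> reach distinct leaders; the size grows by at most
    \<open>k < m\<close>, which the factor \<open>\<theta> ^ m\<close> pays for.\<close>
  have step: "\<theta> ^ m * gf {x \<in> leaders. y x k \<in> bad i} \<theta> \<le> gf (bad i) \<theta>" if k: "k < m" for k
  proof -
    let ?X = "{x \<in> leaders. y x k \<in> bad i}"
    have inj: "inj_on (\<lambda>x. y x k) ?X"
    proof (rule inj_onI)
      fix x x' assume h: "x \<in> ?X" "x' \<in> ?X" "y x k = y x' k"
      then have "eqv (sym_diff x (T k)) (sym_diff x' (T k))"
        using eqv_trans[OF y_leader(2)[of x k], of "sym_diff x' (T k)"] eqv_sym[OF y_leader(2)[of x' k]] k
        by simp
      from eqv_sym_diff[OF this eqv_refl[of "T k"]]
      have "eqv (sym_diff (sym_diff x (T k)) (T k)) (sym_diff (sym_diff x' (T k)) (T k))" .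
      moreover have "sym_diff (sym_diff z (T k)) (T k) = z" for z by auto
      ultimately have "eqv x x'" by (simp only:)
      then show "x = x'" using h leaders_eqv_eq by auto
    qed
    have "\<theta> ^ m * gf ?X \<theta> = (\<Sum>x\<in>?X. \<theta> ^ (m + card x))"
      by (simp add: gf_def sum_distrib_left power_add)
    also have "\<dots> \<le> (\<Sum>x\<in>?X. \<theta> ^ card (y x k))"
    proof (intro sum_mono power_decreasing \<theta>)
      fix x assume "x \<in> ?X"
      then have x: "x \<in> leaders" by simp
      have fT: "finite (T k)" by (simp add: T_def)
      have "card (y x k) \<le> card (sym_diff x (T k))"
        unfolding y_def using card_leader_le[OF sub[OF x]] k by simp
      also have "\<dots> \<le> card (x \<union> T k)"
        using finite_leader[OF x] fT by (intro card_mono) auto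
      also have "\<dots> \<le> card x + card (T k)" by (rule card_Un_le)
      also have "\<dots> \<le> m + card x" using cT[of k] k by simp
      finally show "card (y x k) \<le> m + card x" .
    qed
    also have "\<dots> = (\<Sum>z\<in>(\<lambda>x. y x k) ` ?X. \<theta> ^ card z)"
      by (simp add: sum.reindex[OF inj])
    also have "\<dots> \<le> gf (bad i) \<theta>"
      unfolding gf_def by (intro sum_mono2 finite_bad) (auto simp: \<theta>)
    finally show ?thesis .
  qed
  have "gf (up i) \<theta> \<le> gf (\<Union>k<m. {x \<in> leaders. y x k \<in> bad i}) \<theta>"
    unfolding gf_def using up_sub \<theta> finite_leaders by (intro sum_mono2) auto
  also have "\<dots> \<le> (\<Sum>k<m. gf {x \<in> leaders. y x k \<in> bad i} \<theta>)"
    using \<theta>(1) by (rule gf_UN_le) (use finite_leaders in auto)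
  finally have "\<theta> ^ m * gf (up i) \<theta> \<le> \<theta> ^ m * (\<Sum>k<m. gf {x \<in> leaders. y x k \<in> bad i} \<theta>)"
    using \<theta> by (intro mult_left_mono) auto
  also have "\<dots> = (\<Sum>k<m. \<theta> ^ m * gf {x \<in> leaders. y x k \<in> bad i} \<theta>)"
    by (simp add: sum_distrib_left)
  also have "\<dots> \<le> (\<Sum>k<m. gf (bad i) \<theta>)"
    using step by (intro sum_mono) auto
  finally show ?thesis by (simp add: m_def)
qed

end

section \<open>The differential inequality for the generating function\<close>

context leader_order
begin

text \<open>Differentiation turns a leader of size k into k copies of
  \<open>\<theta> ^ (k - 1)\<close>, one for each removable element \<open>i\<close>, and removing
  \<open>i\<close> lands in \<open>up i\<close>.\<close>

lemma gf_deriv: "(gf leaders has_real_derivative (\<Sum>i\<in>V. gf (up i) \<theta>)) (at \<theta>)"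
proof -
  have "(\<Sum>i\<in>V. gf (up i) \<theta>) = (\<Sum>i\<in>V. \<Sum>x\<in>leaders. if i \<in> x then \<theta> ^ (card x - 1) else 0)"
  proof (rule sum.cong[OF refl])
    fix i
    have "gf (up i) \<theta> = (\<Sum>x\<in>insert i ` up i. \<theta> ^ (card x - 1))"
    proof -
      have "inj_on (insert i) (up i)" by (auto simp: up_def inj_on_def)
      then have "(\<Sum>x\<in>insert i ` up i. \<theta> ^ (card x - 1)) = (\<Sum>x\<in>up i. \<theta> ^ (card (insert i x) - 1))"
        by (simp add: sum.reindex)
      also have "\<dots> = gf (up i) \<theta>"
        unfolding gf_def using finite_leader by (intro sum.cong refl) (auto simp: up_def)
      finally show ?thesis by simp
    qed
    also have "insert i ` up i = {x \<in> leaders. i \<in> x}"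
    proof
      show "{x \<in> leaders. i \<in> x} \<subseteq> insert i ` up i"
      proof
        fix x assume "x \<in> {x \<in> leaders. i \<in> x}"
        then have "x - {i} \<in> up i" "x = insert i (x - {i})"
          using leaders_remove[of x i] by (auto simp: up_def insert_absorb)
        then show "x \<in> insert i ` up i" by blast
      qed
    qed (auto simp: up_def)
    finally show "gf (up i) \<theta> = (\<Sum>x\<in>leaders. if i \<in> x then \<theta> ^ (card x - 1) else 0)"
      unfolding sum.inter_filter[OF finite_leaders] .
  qed
  also have "\<dots> = (\<Sum>x\<in>leaders. \<Sum>i\<in>V. if i \<in> x then \<theta> ^ (card x - 1) else 0)"
    by (rule sum.swap)
  also have "\<dots> = (\<Sum>x\<in>leaders. real (card x) * \<theta> ^ (card x - 1))"
  proof (rule sum.cong[OF refl])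
    fix x assume "x \<in> leaders"
    then have "V \<inter> x = x" using leaders_sub by blast
    then show "(\<Sum>i\<in>V. if i \<in> x then \<theta> ^ (card x - 1) else 0) = real (card x) * \<theta> ^ (card x - 1)"
      using finite_V by (simp add: sum.If_cases)
  qed
  finally show ?thesis
    unfolding gf_def by (auto intro!: derivative_eq_intros sum.cong)
qed

text \<open>Summed over all coordinates, \<open>gf_split\<close> reduces the claim to a lower bound
  \<open>\<theta> ^ w / (2 * w)\<close> for the share of \<open>bad i\<close> with
  \<open>i \<in> I\<close>; the second factor \<open>w\<close> in the denominator comes from
  \<open>n \<le> w * card I\<close>.\<close>

lemma gf_deriv_le:
  assumes I: "I \<subseteq> V" "n \<le> w * card I" and w: "w > 0"
    and dual: "\<And>i. i \<in> I \<Longrightarrow> \<exists>p\<subseteq>V. i \<in> p \<and> eqv p {} \<and> card p \<le> w \<and> (\<forall>j\<in>p - {i}. \<omega> j < \<omega> i)"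
    and \<theta>: "0 \<le> \<theta>" "\<theta> \<le> 1"
  shows "(1 + \<theta>) * (\<Sum>i\<in>V. gf (up i) \<theta>)
    \<le> real n * (1 - \<theta> ^ w / (2 * real w ^ 2)) * gf leaders \<theta>"
proof -
  let ?G = "gf leaders \<theta>"
  have bad: "\<theta> ^ w * ?G / (2 * real w) \<le> gf (bad i) \<theta>" if i: "i \<in> I" for i
  proof -
    obtain p where p: "p \<subseteq> V" "i \<in> p" "eqv p {}" "card p \<le> w" "\<And>j. j \<in> p - {i} \<Longrightarrow> \<omega> j < \<omega> i"
      using dual[OF i] by blast
    have "finite p" using p(1) finite_V finite_subset by blast
    then have "card p > 0" using p(2) by (auto simp: card_gt_0_iff)
    define m where "m = card p - 1"
    have m: "m + 1 \<le> w" using p(4) \<open>card p > 0\<close> by (simp add: m_def)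
    let ?U = "gf (up i) \<theta>" and ?B = "gf (bad i) \<theta>"
    have U0: "?U \<ge> 0" "?B \<ge> 0" using \<theta> by (auto intro: gf_nonneg)
    have ub: "\<theta> ^ m * ?U \<le> real m * ?B"
      unfolding m_def by (rule up_le_bad[OF p(1,2,3,5) \<theta>])
    \<comment> \<open>The constant 2w: \<open>1 + \<theta> \<le> 2\<close> and
      \<open>\<theta> ^ w \<le> \<theta> ^ m\<close> bound the \<open>up\<close> part by
      \<open>2 * m\<close> copies of the bad part, and \<open>2 * m + 1 \<le> 2 * w\<close>.\<close>
    have "\<theta> ^ w * ?G = \<theta> ^ w * ((1 + \<theta>) * ?U) + \<theta> ^ w * ?B"
      by (simp add: gf_split[of \<theta> i] algebra_simps)
    also have "\<theta> ^ w * ((1 + \<theta>) * ?U) \<le> \<theta> ^ m * (2 * ?U)"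
      using \<theta> U0 m by (intro mult_mono power_decreasing) auto
    also have "\<theta> ^ w * ?B \<le> 1 * ?B"
      using \<theta> U0 by (intro mult_right_mono power_le_one) auto
    finally have "\<theta> ^ w * ?G \<le> 2 * (\<theta> ^ m * ?U) + ?B" by simp
    also have "\<dots> \<le> (2 * real m + 1) * ?B" using ub by (simp add: algebra_simps)
    also have "\<dots> \<le> 2 * real w * ?B" using m U0 by (intro mult_right_mono) auto
    finally show ?thesis using w by (simp add: field_simps)
  qed
  have G0: "?G \<ge> 0" using \<theta> by (rule_tac gf_nonneg)
  have "real n * \<theta> ^ w / (2 * real w ^ 2) * ?G \<le> real (w * card I) * \<theta> ^ w / (2 * real w ^ 2) * ?G"
    using I \<theta> G0 by (intro mult_right_mono divide_right_mono) (auto simp del: of_nat_mult)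
  also have "\<dots> = (\<Sum>i\<in>I. \<theta> ^ w * ?G / (2 * real w))"
    using w by (simp add: power2_eq_square)
  also have "\<dots> \<le> (\<Sum>i\<in>I. gf (bad i) \<theta>)" by (intro sum_mono bad)
  also have "\<dots> \<le> (\<Sum>i\<in>V. gf (bad i) \<theta>)"
    using I finite_V \<theta> by (intro sum_mono2) (auto intro: gf_nonneg)
  finally have "real n * \<theta> ^ w / (2 * real w ^ 2) * ?G \<le> (\<Sum>i\<in>V. gf (bad i) \<theta>)" .
  moreover have "(1 + \<theta>) * (\<Sum>i\<in>V. gf (up i) \<theta>) = (\<Sum>i\<in>V. ?G - gf (bad i) \<theta>)"
    unfolding sum_distrib_left by (rule sum.cong[OF refl]) (use gf_split in \<open>simp add: algebra_simps\<close>)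
  ultimately show ?thesis
    by (simp add: sum_subtractf algebra_simps)
qed

text \<open>The inequality of \<open>gf_deriv_le\<close> is integrated from 0: \<open>\<Phi>\<close>
  vanishes there, as only the empty leader counts, and its derivative is nonpositive. Bounding
  \<open>1 + x\<close> by 2 turns \<open>2 * w ^ 2\<close> into \<open>4 * w ^ 2\<close>, and
  integrating \<open>x ^ w\<close> gives the factor \<open>1 / (w + 1)\<close>.\<close>

lemma gf_bound:
  assumes I: "I \<subseteq> V" "n \<le> w * card I" and w: "w > 0"
    and dual: "\<And>i. i \<in> I \<Longrightarrow> \<exists>p\<subseteq>V. i \<in> p \<and> eqv p {} \<and> card p \<le> w \<and> (\<forall>j\<in>p - {i}. \<omega> j < \<omega> i)"
    and \<theta>: "0 \<le> \<theta>" "\<theta> \<le> 1"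
  shows "gf leaders \<theta> \<le> (1 + \<theta>) ^ n * exp (- (real n * \<theta> ^ (w + 1) / (4 * real w ^ 2 * real (w + 1))))"
proof -
  define c where "c = real n / (4 * real w ^ 2)"
  define \<Phi> where "\<Phi> x = ln (gf leaders x) - real n * ln (1 + x) + c * (x ^ (w + 1) / real (w + 1))" for x
  have G1: "gf leaders x \<ge> 1" if "x \<ge> 0" for x
  proof -
    have "x ^ card ({} :: 'a set) \<le> gf leaders x"
      unfolding gf_def using that finite_leaders empty_leader
      by (intro member_le_sum[of "{}" leaders "\<lambda>l. x ^ card l"]) auto
    then show ?thesis by simp
  qed
  have G0: "gf leaders 0 = 1"
  proof -
    have "gf leaders 0 = (\<Sum>x\<in>leaders. if x = {} then 1 else 0)"
      unfolding gf_def using finite_leader by (intro sum.cong refl) (auto simp: power_0_left)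
    then show ?thesis using finite_leaders empty_leader by simp
  qed
  have deriv: "(\<Phi> has_real_derivative
      ((\<Sum>i\<in>V. gf (up i) x) / gf leaders x - real n / (1 + x) + c * x ^ w)) (at x)" if "0 \<le> x" for x
  proof -
    have "((\<lambda>x. ln (gf leaders x)) has_real_derivative (\<Sum>i\<in>V. gf (up i) x) / gf leaders x) (at x)"
      using DERIV_chain2[OF DERIV_ln_divide[of "gf leaders x"] gf_deriv] G1[OF that] by simp
    moreover have "((\<lambda>x. real n * ln (1 + x)) has_real_derivative real n / (1 + x)) (at x)"
      using that by (auto intro!: derivative_eq_intros)
    moreover have "((\<lambda>x. c * (x ^ (w + 1) / real (w + 1))) has_real_derivative c * x ^ w) (at x)"
    proof -
      have "((\<lambda>x. x ^ (w + 1)) has_real_derivative real (w + 1) * x ^ w) (at x)"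
        using DERIV_pow[of "w + 1" x] by simp
      from DERIV_cmult[OF DERIV_cdivide[OF this, of "real (w + 1)"], of c] show ?thesis
        by (simp del: of_nat_add of_nat_Suc)
    qed
    ultimately show ?thesis
      unfolding \<Phi>_def by (intro DERIV_add DERIV_diff)
  qed
  have "\<Phi> \<theta> \<le> \<Phi> 0"
  proof (rule DERIV_nonpos_imp_nonincreasing[OF \<theta>(1)])
    fix x assume x: "0 \<le> x" "x \<le> \<theta>"
    have x1: "x \<le> 1" using x \<theta> by simp
    let ?D = "(\<Sum>i\<in>V. gf (up i) x) / gf leaders x - real n / (1 + x) + c * x ^ w"
    have "(1 + x) * ((\<Sum>i\<in>V. gf (up i) x) / gf leaders x) \<le> real n * (1 - x ^ w / (2 * real w ^ 2))"
      using gf_deriv_le[OF I w dual x(1) x1] G1[OF x(1)] by (simp add: field_simps)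
    moreover have "(1 + x) * (c * x ^ w) \<le> 2 * (c * x ^ w)"
      using x x1 by (intro mult_right_mono) (auto simp: c_def)
    moreover have "2 * (c * x ^ w) = real n * (x ^ w / (2 * real w ^ 2))"
      by (simp add: c_def)
    moreover have "(1 + x) * ?D = (1 + x) * ((\<Sum>i\<in>V. gf (up i) x) / gf leaders x) - real n + (1 + x) * (c * x ^ w)"
      using x by (simp add: field_simps)
    ultimately have "(1 + x) * ?D \<le> 0" by (simp add: right_diff_distrib)
    then have "?D \<le> 0" using x by (simp add: mult_le_0_iff)
    then show "\<exists>y. (\<Phi> has_real_derivative y) (at x) \<and> y \<le> 0"
      using deriv[OF x(1)] by blast
  qed
  also have "\<Phi> 0 = 0" by (simp add: \<Phi>_def G0)
  finally have "ln (gf leaders \<theta>) \<le> real n * ln (1 + \<theta>) - c * (\<theta> ^ (w + 1) / real (w + 1))"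
    by (simp add: \<Phi>_def)
  then have "exp (ln (gf leaders \<theta>)) \<le> exp (real n * ln (1 + \<theta>) + - (c * (\<theta> ^ (w + 1) / real (w + 1))))"
    by simp
  then have "gf leaders \<theta> \<le> exp (ln (1 + \<theta>)) ^ n * exp (- (c * (\<theta> ^ (w + 1) / real (w + 1))))"
    using G1[OF \<theta>(1)] unfolding exp_add exp_of_nat_mult by simp
  then show ?thesis using \<theta> by (simp add: c_def)
qed

text \<open>The Chernoff step: for \<open>\<theta> \<le> 1\<close> a leader of size at most
  \<open>t\<close> contributes at least \<open>\<theta> ^ t\<close>.\<close>

lemma card_leaders_le:
  assumes "0 \<le> \<theta>" "\<theta> \<le> 1"
  shows "real (card {x \<in> leaders. card x \<le> t}) * \<theta> ^ t \<le> gf leaders \<theta>"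
proof -
  have "real (card {x \<in> leaders. card x \<le> t}) * \<theta> ^ t = (\<Sum>x\<in>{x \<in> leaders. card x \<le> t}. \<theta> ^ t)" by simp
  also have "\<dots> \<le> gf {x \<in> leaders. card x \<le> t} \<theta>"
    unfolding gf_def using assms by (intro sum_mono power_decreasing) auto
  also have "\<dots> \<le> gf leaders \<theta>"
    unfolding gf_def using assms finite_leaders by (intro sum_mono2) auto
  finally show ?thesis .
qed

end

section \<open>Choice of the order and the resulting size bound\<close>

context linear_code
begin

text \<open>The common offset \<open>M\<close> exceeds every sum of the powers of two, so
  cardinality decides first; among sets of equal size the binary expansions decide, hence all sums
  differ.\<close>

lemma leader_order_exists:
  fixes pos :: "'a \<Rightarrow> nat"
  assumes inj: "inj_on pos V"
  obtains \<omega> where "leader_order V C \<omega>" "\<And>i j. pos i < pos j \<Longrightarrow> \<omega> i < \<omega> j"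
proof -
  define M where "M = Suc (\<Sum>i\<in>V. 2 ^ pos i :: nat)"
  define \<omega> where "\<omega> i = M + 2 ^ pos i" for i
  have sum_enc: "(\<Sum>i\<in>x. 2 ^ pos i) = set_encode (pos ` x)" if "x \<subseteq> V" for x
    using inj_on_subset[OF inj that] by (simp add: set_encode_def sum.reindex)
  have lt: "(\<Sum>i\<in>x. 2 ^ pos i) < M" if "x \<subseteq> V" for x
    using that finite_V by (auto simp: M_def less_Suc_eq_le intro: sum_mono2)
  have sum_w: "sum \<omega> x = card x * M + (\<Sum>i\<in>x. 2 ^ pos i)" for x
    by (simp add: \<omega>_def sum.distrib)
  have mono: "sum \<omega> x < sum \<omega> y" if "x \<subseteq> V" "y \<subseteq> V" "card x < card y" for x y
  proof -
    have "sum \<omega> x < Suc (card x) * M" using lt[OF that(1)] by (simp add: sum_w)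
    also have "\<dots> \<le> card y * M" using that(3) by (intro mult_right_mono) auto
    finally show ?thesis by (simp add: sum_w)
  qed
  have "inj_on (sum \<omega>) (Pow V)"
  proof (rule inj_onI)
    fix x y assume h: "x \<in> Pow V" "y \<in> Pow V" "sum \<omega> x = sum \<omega> y"
    then have "card x = card y"
      using mono[of x y] mono[of y x] by (metis PowD less_irrefl nat_neq_iff)
    then have "set_encode (pos ` x) = set_encode (pos ` y)"
      using h sum_enc[of x] sum_enc[of y] by (simp add: sum_w)
    moreover have "finite x" "finite y" using h finite_V finite_subset by auto
    ultimately have "pos ` x = pos ` y" by (simp add: set_encode_eq)
    then show "x = y" using h inj by (simp add: inj_on_image_eq_iff)
  qed
  then have "leader_order V C \<omega>"
    using mono by unfold_locales auto
  moreover have "\<omega> i < \<omega> j" if "pos i < pos j" for i j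
    using that by (simp add: \<omega>_def)
  ultimately show ?thesis using that by blast
qed

text \<open>Each round takes an uncovered \<open>i\<close> with a short dual word \<open>p\<close>
  and places the new elements of \<open>p\<close> after all earlier ones, with \<open>i\<close>
  last. This makes \<open>i\<close> the largest element of \<open>p\<close> and covers at most
  \<open>w\<close> new coordinates per element of \<open>I\<close>.\<close>

lemma greedy_positions:
  assumes dual: "\<And>i. i \<in> V \<Longrightarrow> \<exists>p\<subseteq>V. i \<in> p \<and> eqv p {} \<and> card p \<le> w"
  shows "\<exists>W I pos. I \<subseteq> W \<and> W \<subseteq> V \<and> inj_on pos W \<and> card W \<le> w * card I \<and> (W = V \<or> k \<le> card I) \<and>
    (\<forall>i\<in>I. \<exists>p\<subseteq>W. i \<in> p \<and> eqv p {} \<and> card p \<le> w \<and> (\<forall>j\<in>p - {i}. pos j < (pos i :: nat)))"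
proof (induction k)
  case 0
  show ?case by (intro exI[of _ "{}"] exI[of _ "\<lambda>_. 0"]) auto
next
  case (Suc k)
  then obtain W I pos where h: "I \<subseteq> W" "W \<subseteq> V" "inj_on pos W" "card W \<le> w * card I" "W = V \<or> k \<le> card I"
    and good: "\<forall>i\<in>I. \<exists>p\<subseteq>W. i \<in> p \<and> eqv p {} \<and> card p \<le> w \<and> (\<forall>j\<in>p - {i}. pos j < (pos i :: nat))"
    by blast
  show ?case
  proof (cases "W = V")
    case True
    then show ?thesis using h good by blast
  next
    case False
    then obtain i where i: "i \<in> V" "i \<notin> W" using h by blast
    obtain p where p: "p \<subseteq> V" "i \<in> p" "eqv p {}" "card p \<le> w" using dual[OF i(1)] by blast
    have fin: "finite W" "finite p" "finite I"
      using h p finite_V by (meson finite_subset)+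
    obtain e :: "'a \<Rightarrow> nat" where e: "inj_on e (p - W)"
      using finite_imp_inj_to_nat_seg[of "p - W"] fin by auto
    \<comment> \<open>\<open>N\<close> lies above all old positions and \<open>N'\<close> above
      those given to the other new elements of \<open>p\<close>; inserting 0 keeps
      \<open>Max\<close> meaningful for empty \<open>W\<close>.\<close>
    define N where "N = Suc (Max (insert 0 (pos ` W)))"
    define N' where "N' = Suc (N + Max (insert 0 (e ` p)))"
    define pos' where "pos' j = (if j \<in> W then pos j else if j = i then N' else N + e j)" for j
    have N: "pos j < N" if "j \<in> W" for j
      using that fin by (simp add: N_def less_Suc_eq_le)
    have N': "N + e j < N'" if "j \<in> p" for j
      using that fin by (simp add: N'_def less_Suc_eq_le)
    have NN': "N < N'" by (simp add: N'_def)
    have inj: "inj_on pos' (W \<union> p)"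
    proof (rule inj_onI)
      fix a b assume "a \<in> W \<union> p" "b \<in> W \<union> p" "pos' a = pos' b"
      then show "a = b"
        using N[of a] N[of b] N'[of a] N'[of b] NN' inj_onD[OF h(3), of a b] inj_onD[OF e, of a b]
        unfolding pos'_def by (auto split: if_splits)
    qed
    have top: "pos' j < pos' i" if "j \<in> p - {i}" for j
      using that N[of j] N'[of j] NN' i by (auto simp: pos'_def)
    have "i \<notin> I" using h i by blast
    then have cI: "card (insert i I) = Suc (card I)" using fin by simp
    have "card (W \<union> p) \<le> card W + card p" by (rule card_Un_le)
    also have "\<dots> \<le> w * card (insert i I)" using h(4) p(4) by (simp add: cI)
    finally have c: "card (W \<union> p) \<le> w * card (insert i I)" .
    have "\<exists>q\<subseteq>W \<union> p. j \<in> q \<and> eqv q {} \<and> card q \<le> w \<and> (\<forall>l\<in>q - {j}. pos' l < pos' j)"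
      if j: "j \<in> insert i I" for j
    proof (cases "j = i")
      case True
      then show ?thesis using p top by (intro exI[of _ p]) auto
    next
      case False
      then have "j \<in> I" using j by simp
      then obtain q where q: "q \<subseteq> W" "j \<in> q" "eqv q {}" "card q \<le> w" "\<forall>l\<in>q - {j}. pos l < pos j"
        using good by blast
      \<comment> \<open>Positions inside \<open>W\<close> are unchanged, so earlier dual words keep
        their largest elements.\<close>
      moreover have "\<forall>l\<in>q - {j}. pos' l < pos' j"
        using q by (auto simp: pos'_def subset_iff)
      ultimately show ?thesis by (intro exI[of _ q]) auto
    qed
    moreover have "insert i I \<subseteq> W \<union> p" "W \<union> p \<subseteq> V" using h p by auto
    moreover have "W \<union> p = V \<or> Suc k \<le> card (insert i I)" using h(5) False cI by auto
    ultimately show ?thesis using inj c by blast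
  qed
qed

text \<open>The leader map serves as \<open>rep\<close>, since a leader is no larger than the sets
  it represents; the leaders of size at most \<open>t\<close> are then counted through the
  generating function.\<close>

theorem code_size_bound:
  fixes \<phi> :: "nat \<Rightarrow> real" and lam d :: real
  assumes w: "w > 0"
    and dual: "\<And>i. i \<in> V \<Longrightarrow> \<exists>p\<subseteq>V. i \<in> p \<and> eqv p {} \<and> card p \<le> w"
    and nonneg: "\<And>k. \<phi> k \<ge> 0"
    and supp: "\<And>k. k > t \<Longrightarrow> \<phi> k = 0"
    and pos: "k0 \<le> n" "\<phi> k0 > 0"
    and eigen: "\<And>k. k \<le> n \<Longrightarrow> lam * \<phi> k \<le> real k * \<phi> (k - 1) + (real n - real k) * \<phi> (k + 1)"
    and dist: "\<And>u. u \<in> C \<Longrightarrow> u \<noteq> {} \<Longrightarrow> d \<le> real (card u)"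
    and lam: "real n - 2 * d \<le> lam" and d: "d \<ge> 0"
    and \<theta>: "0 \<le> \<theta>" "\<theta> \<le> 1"
  shows "real (card C) * (lam - (real n - 2 * d)) * \<theta> ^ t \<le>
    2 * d * ((1 + \<theta>) ^ n * exp (- (real n * \<theta> ^ (w + 1) / (4 * real w ^ 2 * real (w + 1)))))"
proof -
  \<comment> \<open>\<open>I\<close> cannot have \<open>Suc n\<close> elements inside
    \<open>V\<close>, which forces \<open>W = V\<close>.\<close>
  obtain W I and pos :: "'a \<Rightarrow> nat" where h: "I \<subseteq> W" "W \<subseteq> V" "inj_on pos W" "card W \<le> w * card I"
      "W = V \<or> Suc n \<le> card I"
    and good: "\<forall>i\<in>I. \<exists>p\<subseteq>W. i \<in> p \<and> eqv p {} \<and> card p \<le> w \<and> (\<forall>j\<in>p - {i}. pos j < pos i)"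
    using greedy_positions[OF dual, of "Suc n"] by blast
  have "card I \<le> n" using h finite_V by (intro card_mono) auto
  then have W: "W = V" using h by auto
  obtain \<omega> where \<omega>: "leader_order V C \<omega>" "\<And>i j. pos i < pos j \<Longrightarrow> \<omega> i < \<omega> j"
    using leader_order_exists[of pos] h(3) W by blast
  interpret leader_order V C \<omega> by (rule \<omega>(1))
  let ?K = "{x \<in> leaders. card x \<le> t}"
  have rep: "leader x \<in> ?K \<and> eqv x (leader x)" if "x \<subseteq> V" "card x \<le> t" for x
    using leader[OF that(1)] card_leader_le[OF that(1)] that(2) by auto
  have "real (card C) * (lam - (real n - 2 * d)) \<le> 2 * d * real (card ?K)"
    by (rule spectral_bound[OF nonneg supp pos eigen dist lam rep]) (use finite_leaders in auto)
  then have "real (card C) * (lam - (real n - 2 * d)) * \<theta> ^ t \<le> 2 * d * real (card ?K) * \<theta> ^ t"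
    using \<theta> by (intro mult_right_mono) auto
  also have "\<dots> = 2 * d * (real (card ?K) * \<theta> ^ t)" by simp
  also have "\<dots> \<le> 2 * d * gf leaders \<theta>"
    using card_leaders_le[OF \<theta>] d by (intro mult_left_mono) auto
  also have "\<dots> \<le> 2 * d * ((1 + \<theta>) ^ n * exp (- (real n * \<theta> ^ (w + 1) / (4 * real w ^ 2 * real (w + 1)))))"
  proof (intro mult_left_mono gf_bound \<theta> w)
    show "I \<subseteq> V" "n \<le> w * card I" using h W by auto
    show "\<exists>p\<subseteq>V. i \<in> p \<and> eqv p {} \<and> card p \<le> w \<and> (\<forall>j\<in>p - {i}. \<omega> j < \<omega> i)" if "i \<in> I" for i
    proof -
      obtain p where "p \<subseteq> V" "i \<in> p" "eqv p {}" "card p \<le> w" "\<forall>j\<in>p - {i}. pos j < pos i"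
        using good \<open>i \<in> I\<close> W by blast
      then show ?thesis using \<omega>(2) by (intro exI[of _ p]) simp
    qed
  qed (use d in auto)
  finally show ?thesis .
qed

end

section \<open>Explicit bounds and shortening\<close>

text \<open>The parabola \<open>j \<mapsto> (j + 1) (m + 1 - j)\<close> on \<open>{0..m}\<close> has constant second difference \<open>- 2\<close> and
  values at least \<open>m + 1\<close>, so it is an approximate eigenvector of a path with eigenvalue
  \<open>2 (1 - 1 / (m + 1))\<close>.\<close>

lemma window_eigenvector:
  fixes a m N :: nat and lam :: real
  defines "\<rho> \<equiv> sqrt (real a / real (N - a - m))"
    and "lam \<equiv> 2 * sqrt (real a * real (N - a - m)) * (1 - 1 / real (m + 1))"
  defines "\<phi> \<equiv> \<lambda>k. if a \<le> k \<and> k \<le> a + m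
      then \<rho> ^ k * ((real k - real a + 1) * (real m + 1 - (real k - real a))) else 0"
  assumes a: "a > 0" and N: "a + m < N" and k: "k \<le> N"
  shows "lam * \<phi> k \<le> real k * \<phi> (k - 1) + (real N - real k) * \<phi> (k + 1)"
proof -
  define p where "p = real a"
  define q where "q = real (N - a - m)"
  have pq: "p > 0" "q > 0" using a N by (auto simp: p_def q_def)
  have \<rho>: "\<rho> > 0" using pq by (simp add: \<rho>_def p_def q_def)
  have pos: "\<phi> l \<ge> 0" for l using \<rho> by (auto simp: \<phi>_def)
  show ?thesis
  proof (cases "a \<le> k \<and> k \<le> a + m")
    case False
    then have "\<phi> k = 0" by (auto simp: \<phi>_def)
    then show ?thesis using pos k by simp
  next
    case True
    define \<beta> where "\<beta> j = (j + 1) * (real m + 1 - j)" for j :: real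
    define j where "j = real k - real a"
    have j: "0 \<le> j" "j \<le> real m" using True by (auto simp: j_def)
    have \<phi>k: "\<phi> k = \<rho> ^ k * \<beta> j" using True by (simp add: \<phi>_def \<beta>_def j_def)
    \<comment> \<open>The parabola vanishes at -1 and at m + 1, so its formula stays valid one step
      outside the window at either end.\<close>
    have prev: "\<phi> (k - 1) = \<rho> ^ (k - 1) * \<beta> (j - 1)"
    proof (cases "k = a")
      case True
      then show ?thesis using a by (auto simp: \<phi>_def \<beta>_def j_def)
    next
      case False
      then have "a \<le> k - 1" "k - 1 \<le> a + m" "real (k - 1) = real k - 1" using \<open>a \<le> k \<and> k \<le> a + m\<close> by auto
      then show ?thesis by (simp add: \<phi>_def \<beta>_def j_def algebra_simps)
    qed
    have nxt: "\<phi> (k + 1) = \<rho> ^ (k + 1) * \<beta> (j + 1)"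
    proof (cases "k = a + m")
      case True
      then show ?thesis by (auto simp: \<phi>_def \<beta>_def j_def)
    next
      case False
      then show ?thesis using True by (simp add: \<phi>_def \<beta>_def j_def algebra_simps)
    qed
    \<comment> \<open>\<open>\<rho>\<close> symmetrises the recursion: with coefficients
      \<open>p\<close> and \<open>q\<close>, the lower and the upper neighbour both acquire the
      factor \<open>\<sigma> * \<rho> ^ k\<close>.\<close>
    define \<sigma> where "\<sigma> = sqrt (p * q)"
    have \<rho>': "\<rho> = sqrt p / sqrt q" by (simp add: \<rho>_def p_def q_def real_sqrt_divide)
    have \<rho>q: "q * \<rho> = \<sigma>"
      using pq by (simp add: \<rho>' \<sigma>_def real_sqrt_mult real_div_sqrt field_simps)
    have \<rho>p: "\<rho> * \<sigma> = p"
      using pq by (simp add: \<rho>' \<sigma>_def real_sqrt_mult)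
    have prev_pow: "p * \<rho> ^ (k - 1) = \<sigma> * \<rho> ^ k"
    proof -
      have "k = Suc (k - 1)" using True a by simp
      then have "\<rho> ^ k = \<rho> * \<rho> ^ (k - 1)" by (metis power_Suc)
      then show ?thesis using \<rho>p by (simp add: mult_ac)
    qed
    have next_pow: "q * \<rho> ^ (k + 1) = \<sigma> * \<rho> ^ k"
      using \<rho>q by (simp add: mult_ac)
    have \<beta>m: "\<beta> j \<ge> real m + 1"
    proof -
      have "\<beta> j = real m + 1 + j * (real m - j)" by (simp add: \<beta>_def algebra_simps)
      then show ?thesis using j by simp
    qed
    have "lam * \<phi> k = \<sigma> * \<rho> ^ k * (2 * \<beta> j - 2 * (\<beta> j / (real m + 1)))"
      by (simp add: lam_def \<phi>k \<sigma>_def p_def q_def algebra_simps)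
    \<comment> \<open>As \<open>\<beta> j \<ge> m + 1\<close>, the factor
      \<open>1 - 1 / (m + 1)\<close> loses at least the 2 of the second difference.\<close>
    also have "\<dots> \<le> \<sigma> * \<rho> ^ k * (2 * \<beta> j - 2 * 1)"
      using \<beta>m pq \<rho> by (intro mult_left_mono diff_left_mono) (auto simp: \<sigma>_def)
    also have "2 * \<beta> j - 2 * 1 = \<beta> (j - 1) + \<beta> (j + 1)" by (simp add: \<beta>_def algebra_simps)
    also have "\<sigma> * \<rho> ^ k * (\<beta> (j - 1) + \<beta> (j + 1)) =
        p * \<rho> ^ (k - 1) * \<beta> (j - 1) + q * \<rho> ^ (k + 1) * \<beta> (j + 1)"
      by (simp only: prev_pow next_pow distrib_left)
    also have "\<dots> = p * \<phi> (k - 1) + q * \<phi> (k + 1)" by (simp only: prev nxt mult.assoc)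
    also have "\<dots> \<le> real k * \<phi> (k - 1) + (real N - real k) * \<phi> (k + 1)"
    proof -
      have "p \<le> real k" "q \<le> real N - real k" using True N k by (auto simp: p_def q_def of_nat_diff)
      then show ?thesis using pos by (intro add_mono mult_right_mono) auto
    qed
    finally show ?thesis .
  qed
qed

section \<open>The exponent at the Chernoff point\<close>

text \<open>At this \<open>\<theta>\<close>, \<open>ln (1 + \<theta>) - \<tau> * ln \<theta>\<close>
  is the entropy of \<open>\<tau>\<close> in natural units. For \<open>\<tau> = 1/2\<close> one has
  \<open>\<theta> = 1\<close>, so \<open>\<theta> ^ t = 1\<close> for every
  \<open>t\<close>.\<close>

lemma leader_exponent_le:
  fixes \<tau> :: real and N t w :: nat
  assumes \<tau>: "0 < \<tau>" "\<tau> \<le> 1/2" and w: "w > 0"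
    and t: "real t \<le> \<tau> * real N \<or> \<tau> = 1/2"
  defines "\<theta> \<equiv> \<tau> / (1 - \<tau>)"
  shows "log 2 ((1 + \<theta>) ^ N * exp (- (real N * \<theta> ^ (w + 1) / (4 * real w ^ 2 * real (w + 1)))) / \<theta> ^ t)
    \<le> real N * (bin_entropy \<tau> - c_const w \<tau>)"
proof -
  have \<theta>: "0 < \<theta>" "\<theta> \<le> 1" "\<tau> \<le> \<theta>" using \<tau> by (auto simp: \<theta>_def field_simps)
  define K where "K = \<theta> ^ (w + 1) / (4 * real w ^ 2 * real (w + 1))"
  have "ln ((1 + \<theta>) ^ N * exp (- (real N * K)) / \<theta> ^ t) = real N * ln (1 + \<theta>) - real N * K - real t * ln \<theta>"
    using \<theta> by (simp add: ln_mult ln_div ln_realpow)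
  also have "\<dots> \<le> real N * ln (1 + \<theta>) - real N * K - \<tau> * real N * ln \<theta>"
  proof (cases "\<tau> = 1/2")
    case True
    then have "\<theta> = 1" by (simp add: \<theta>_def)
    then show ?thesis by simp
  next
    case False
    then have "real t \<le> \<tau> * real N" using t by simp
    moreover have "ln \<theta> \<le> 0" using \<theta> by simp
    ultimately show ?thesis by (simp add: mult_right_mono_neg)
  qed
  also have "\<dots> = real N * ((- \<tau> * ln \<tau> - (1 - \<tau>) * ln (1 - \<tau>)) - K)"
  proof -
    have "1 + \<theta> = 1 / (1 - \<tau>)" using \<tau> by (simp add: \<theta>_def field_simps)
    then have L1: "ln (1 + \<theta>) = - ln (1 - \<tau>)" using \<tau> by (simp add: ln_div)
    have L2: "ln \<theta> = ln \<tau> - ln (1 - \<tau>)" using \<tau> by (simp add: \<theta>_def ln_div)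
    show ?thesis unfolding L1 L2 by (simp add: algebra_simps)
  qed
  \<comment> \<open>The correction in \<open>c_const\<close>, in natural units, is at most
    \<open>K\<close>: use \<open>\<tau> ^ w \<le> \<tau> \<le> \<theta>\<close> and
    \<open>w + 1 \<le> 2 ^ (w + 1)\<close>; the 8 against the 4 is slack.\<close>
  also have "\<dots> \<le> real N * ((- \<tau> * ln \<tau> - (1 - \<tau>) * ln (1 - \<tau>)) - (\<tau> ^ w / 2) ^ (w + 1) / (8 * real w ^ 2))"
  proof (intro mult_left_mono diff_left_mono)
    have "(\<tau> ^ w / 2) ^ (w + 1) \<le> (\<theta> / 2) ^ (w + 1)"
    proof (intro power_mono divide_right_mono)
      have "\<tau> ^ w \<le> \<tau> ^ 1" using \<tau> w by (intro power_decreasing) auto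
      then show "\<tau> ^ w \<le> \<theta>" using \<theta> by simp
    qed (use \<tau> in auto)
    also have "\<dots> = \<theta> ^ (w + 1) / 2 ^ (w + 1)" by (simp add: power_divide)
    also have "\<dots> \<le> \<theta> ^ (w + 1) / real (w + 1)"
    proof (intro divide_left_mono)
      have "w + 1 < 2 ^ (w + 1)" by (rule less_exp)
      then show "real (w + 1) \<le> 2 ^ (w + 1)" by (metis less_imp_le of_nat_le_iff of_nat_numeral of_nat_power)
    qed (use \<theta> in auto)
    finally have "(\<tau> ^ w / 2) ^ (w + 1) / (8 * real w ^ 2) \<le> \<theta> ^ (w + 1) / real (w + 1) / (8 * real w ^ 2)"
      by (intro divide_right_mono) auto
    also have "\<dots> \<le> \<theta> ^ (w + 1) / real (w + 1) / (4 * real w ^ 2)"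
      using w \<theta> by (intro divide_left_mono) auto
    also have "\<dots> = K" by (simp add: K_def mult_ac)
    finally show "(\<tau> ^ w / 2) ^ (w + 1) / (8 * real w ^ 2) \<le> K" .
  qed simp
  finally have "ln ((1 + \<theta>) ^ N * exp (- (real N * K)) / \<theta> ^ t) / ln 2 \<le>
      real N * ((- \<tau> * ln \<tau> - (1 - \<tau>) * ln (1 - \<tau>)) - (\<tau> ^ w / 2) ^ (w + 1) / (8 * real w ^ 2)) / ln 2"
    by (intro divide_right_mono) auto
  also have "\<dots> = real N * (bin_entropy \<tau> - c_const w \<tau>)"
  proof -
    have "bin_entropy \<tau> - c_const w \<tau> =
        ((- \<tau> * ln \<tau> - (1 - \<tau>) * ln (1 - \<tau>)) - (\<tau> ^ w / 2) ^ (w + 1) / (8 * real w ^ 2)) / ln 2"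
      by (simp add: bin_entropy_def c_const_def log_def diff_divide_distrib mult.commute)
    then show ?thesis by simp
  qed
  finally show ?thesis by (simp add: log_def K_def)
qed

section \<open>Dual words from locality, and shortening\<close>

text \<open>Over GF(2), a coordinate functional that vanishes on the common kernel of the
  functionals in \<open>S\<close> is a sum of some of them. The induction step passes to the
  codewords avoiding \<open>s\<close>.\<close>

lemma coordinate_in_span:
  assumes "finite S" "linear_code V C" "\<And>u. u \<in> C \<Longrightarrow> u \<inter> S = {} \<Longrightarrow> i \<notin> u"
  shows "\<exists>T\<subseteq>S. \<forall>u\<in>C. chi {i} u = chi T u"
  using assms
proof (induction S arbitrary: C rule: finite_induct)
  case empty
  then show ?case by (intro exI[of _ "{}"]) (auto simp: chi_singleton)
next
  case (insert s S)
  interpret linear_code V C by fact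
  define C' where "C' = {u \<in> C. s \<notin> u}"
  have "linear_code V C'"
    by unfold_locales (use finite_V code_sub empty_in_code sym_diff_in_code in \<open>auto simp: C'_def\<close>)
  moreover have "i \<notin> u" if "u \<in> C'" "u \<inter> S = {}" for u
    using that insert.prems(2)[of u] by (auto simp: C'_def)
  ultimately have "\<exists>T\<subseteq>S. \<forall>u\<in>C'. chi {i} u = chi T u" by (rule insert.IH)
  then obtain T where T: "T \<subseteq> S" "\<And>u. u \<in> C' \<Longrightarrow> chi {i} u = chi T u" by blast
  have fT: "finite T" "s \<notin> T" using T insert.hyps finite_subset by auto
  show ?case
  proof (cases "\<forall>u\<in>C. chi {i} u = chi T u")
    case True
    then show ?thesis using T by blast
  next
    case False
    then obtain u0 where u0: "u0 \<in> C" "chi {i} u0 \<noteq> chi T u0" by blast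
    then have s0: "s \<in> u0" using T(2)[of u0] by (auto simp: C'_def)
    have neg: "chi {i} u0 = - chi T u0" using u0(2) chi_cases[of "{i}" u0] chi_cases[of T u0] by auto
    \<comment> \<open>Adding \<open>u0\<close>, which contains \<open>s\<close>, moves any codeword
      containing \<open>s\<close> into \<open>C'\<close>, where \<open>T\<close> is correct. As
      \<open>T\<close> is wrong at \<open>u0\<close>, it is wrong at all codewords containing
      \<open>s\<close>, and adding \<open>s\<close> to \<open>T\<close> repairs them.\<close>
    have "chi {i} u = chi (insert s T) u" if u: "u \<in> C" for u
    proof -
      have "insert s T = sym_diff {s} T" using fT by auto
      then have eq: "chi (insert s T) u = chi {s} u * chi T u"
        using chi_sym_diff_left[OF finite_codeword[OF u]] by simp
      show ?thesis
      proof (cases "s \<in> u")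
        case False
        then show ?thesis using T(2)[of u] u eq by (simp add: C'_def chi_singleton)
      next
        case True
        then have "sym_diff u u0 \<in> C'" using u u0(1) s0 sym_diff_in_code by (auto simp: C'_def)
        then have "chi {i} u * chi {i} u0 = chi T u * chi T u0"
          using T(2)[of "sym_diff u u0"] fT by (simp add: chi_sym_diff_right)
        then have "chi {i} u = - chi T u"
          unfolding neg using chi_cases[of T u0] by auto
        then show ?thesis using True eq by (simp add: chi_singleton)
      qed
    qed
    then show ?thesis using T(1) by (intro exI[of _ "insert s T"]) auto
  qed
qed

context linear_code
begin

text \<open>Coordinate \<open>i\<close> is the sum of coordinates \<open>T\<close> in
  \<open>R - {i}\<close>; then \<open>insert i T\<close> is orthogonal to the code.\<close>

lemma dual_word_of_recovering_set:
  assumes "R \<subseteq> V" "i \<in> R" and rec: "\<And>u. u \<in> C \<Longrightarrow> u \<inter> (R - {i}) = {} \<Longrightarrow> i \<notin> u"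
  shows "\<exists>p\<subseteq>R. i \<in> p \<and> eqv p {}"
proof -
  have "finite (R - {i})" using assms(1) finite_V finite_subset by blast
  from coordinate_in_span[OF this linear_code_axioms rec]
  obtain T where T: "T \<subseteq> R - {i}" "\<forall>u\<in>C. chi {i} u = chi T u" by blast
  have "sym_diff {i} T = insert i T" using T(1) by auto
  moreover have "eqv (sym_diff {i} T) (sym_diff T T)"
    by (rule eqv_sym_diff) (use T(2) in \<open>auto simp: eqv_def\<close>)
  ultimately show ?thesis using T(1) assms(2) by (intro exI[of _ "insert i T"]) auto
qed

text \<open>Greedy choice: the recovering set of a coordinate \<open>i\<close> outside
  \<open>A\<close> makes \<open>i\<close> redundant, so every \<open>w\<close> coordinates collected
  yield a determined one. \<open>J\<close> gathers these, and the \<open>q * (w - 1)\<close>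
  coordinates of \<open>A - J\<close> control all of \<open>A\<close>.\<close>

lemma low_rank_coordinates:
  assumes w: "w > 0"
    and rec: "\<And>i. i \<in> V \<Longrightarrow> \<exists>R\<subseteq>V. i \<in> R \<and> card R = w \<and> (\<forall>u\<in>C. u \<inter> (R - {i}) = {} \<longrightarrow> i \<notin> u)"
    and "q * w \<le> n"
  shows "\<exists>A J. J \<subseteq> A \<and> A \<subseteq> V \<and> card J = q \<and> card A = q * w \<and> (\<forall>u\<in>C. u \<inter> (A - J) = {} \<longrightarrow> u \<inter> A = {})"
  using \<open>q * w \<le> n\<close>
proof (induction q)
  case 0
  show ?case by (intro exI[of _ "{}"]) auto
next
  case (Suc q)
  then obtain A J where h: "J \<subseteq> A" "A \<subseteq> V" "card J = q" "card A = q * w"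
      and det: "\<And>u. u \<in> C \<Longrightarrow> u \<inter> (A - J) = {} \<Longrightarrow> u \<inter> A = {}"
    by auto
  have "card A < n" using h(4) Suc.prems w by simp
  then have "A \<noteq> V" by auto
  then obtain i where i: "i \<in> V" "i \<notin> A" using h(2) by blast
  obtain R where R: "R \<subseteq> V" "i \<in> R" "card R = w" "\<forall>u\<in>C. u \<inter> (R - {i}) = {} \<longrightarrow> i \<notin> u"
    using rec[OF i(1)] by blast
  have "card (A \<union> R) \<le> Suc q * w" using card_Un_le[of A R] h(4) R(3) by simp
  \<comment> \<open>Padding to \<open>B\<close> keeps the size an exact multiple of \<open>w\<close>
    even if \<open>R\<close> overlaps \<open>A\<close>.\<close>
  then obtain B where B: "A \<union> R \<subseteq> B" "B \<subseteq> V" "card B = Suc q * w"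
    using exists_subset_between[of "A \<union> R" "Suc q * w" V] Suc.prems h(2) R(1) finite_V by auto
  have "finite J" using h finite_V by (meson finite_subset)
  moreover have "i \<notin> J" using i h by blast
  ultimately have "card (insert i J) = Suc q" using h(3) by simp
  moreover have "u \<inter> B = {}" if u: "u \<in> C" "u \<inter> (B - insert i J) = {}" for u
  proof -
    \<comment> \<open>The order of deduction: first \<open>u\<close> vanishes on \<open>A\<close>,
      then on \<open>R - {i}\<close>, whose points outside \<open>A\<close> lie in
      \<open>B - insert i J\<close>, and only then at \<open>i\<close>.\<close>
    have "u \<inter> (A - J) = {}" using u(2) B(1) i(2) by blast
    then have uA: "u \<inter> A = {}" using det u(1) by blast
    then have "u \<inter> (R - {i}) = {}" using u(2) B(1) h(1) by blast
    then have "i \<notin> u" using R(4) u(1) by blast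
    then show ?thesis using u(2) uA h(1) by blast
  qed
  ultimately show ?case using B R(2) h(1) by (intro exI[of _ B] exI[of _ "insert i J"]) auto
qed

text \<open>Codewords with equal restriction to \<open>B\<close> differ by a codeword vanishing on
  \<open>B\<close>, hence on \<open>A\<close>; there are at most \<open>2 ^ card B\<close>
  restrictions.\<close>

lemma card_code_le_shortened:
  assumes fin: "finite B" and det: "\<And>u. u \<in> C \<Longrightarrow> u \<inter> B = {} \<Longrightarrow> u \<inter> A = {}"
  shows "card C \<le> 2 ^ card B * card {u \<in> C. u \<inter> A = {}}"
proof -
  let ?F = "\<lambda>z. {u \<in> C. u \<inter> B = z}"
  have fibre: "card (?F z) \<le> card {u \<in> C. u \<inter> A = {}}" for z
  proof (cases "?F z = {}")
    case False
    then obtain u0 where u0: "u0 \<in> C" "u0 \<inter> B = z" by blast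
    show ?thesis
    proof (rule card_inj_on_le[where f = "\<lambda>u. sym_diff u u0"])
      show "inj_on (\<lambda>u. sym_diff u u0) (?F z)" by (rule inj_onI) blast
      show "(\<lambda>u. sym_diff u u0) ` ?F z \<subseteq> {u \<in> C. u \<inter> A = {}}"
      proof
        fix v assume "v \<in> (\<lambda>u. sym_diff u u0) ` ?F z"
        then obtain u where u: "u \<in> C" "u \<inter> B = z" "v = sym_diff u u0" by blast
        have "v \<in> C" using u u0 sym_diff_in_code by simp
        moreover have "v \<inter> B = {}" using u u0 by blast
        ultimately show "v \<in> {u \<in> C. u \<inter> A = {}}" using det by blast
      qed
    qed (use finite_code in simp)
  next
    case True
    show ?thesis unfolding True by simp
  qed
  have "C \<subseteq> (\<Union>z\<in>Pow B. ?F z)"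
  proof
    fix u assume "u \<in> C"
    then show "u \<in> (\<Union>z\<in>Pow B. ?F z)" by (intro UN_I[of "u \<inter> B"]) auto
  qed
  moreover have "finite (\<Union>z\<in>Pow B. ?F z)" using fin finite_code by simp
  ultimately have "card C \<le> card (\<Union>z\<in>Pow B. ?F z)" by (rule card_mono[rotated])
  also have "\<dots> \<le> (\<Sum>z\<in>Pow B. card (?F z))"
    by (rule card_UN_le) (use fin in simp)
  also have "\<dots> \<le> (\<Sum>z\<in>Pow B. card {u \<in> C. u \<inter> A = {}})" by (rule sum_mono, rule fibre)
  finally show ?thesis using fin by (simp add: card_Pow)
qed

text \<open>Removing \<open>A\<close> costs \<open>q * (r + 1)\<close> of the length but only
  \<open>q * r\<close> bits of size. A dual word stays dual after deleting its part in
  \<open>A\<close>, since the words of \<open>C'\<close> avoid \<open>A\<close>.\<close>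

lemma shortening:
  assumes rec: "\<And>i. i \<in> V \<Longrightarrow> \<exists>R\<subseteq>V. i \<in> R \<and> card R = r + 1 \<and> (\<forall>u\<in>C. u \<inter> (R - {i}) = {} \<longrightarrow> i \<notin> u)"
    and q: "q * (r + 1) \<le> n"
  shows "\<exists>V' C'. linear_code V' C' \<and> C' \<subseteq> C \<and> card V' = n - q * (r + 1) \<and> card C \<le> 2 ^ (q * r) * card C' \<and>
    (\<forall>i\<in>V'. \<exists>p\<subseteq>V'. i \<in> p \<and> linear_code.eqv C' p {} \<and> card p \<le> r + 1)"
proof -
  obtain A J where h: "J \<subseteq> A" "A \<subseteq> V" "card J = q" "card A = q * (r + 1)"
      and det: "\<And>u. u \<in> C \<Longrightarrow> u \<inter> (A - J) = {} \<Longrightarrow> u \<inter> A = {}"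
    using low_rank_coordinates[OF _ rec q] by (metis add_gr_0 zero_less_one)
  define C' where "C' = {u \<in> C. u \<inter> A = {}}"
  have fin: "finite A" "finite J" using h finite_V by (meson finite_subset)+
  have cAJ: "card (A - J) = q * r"
    using h fin by (simp add: card_Diff_subset)
  have "linear_code (V - A) C'"
    by unfold_locales (use finite_V code_sub empty_in_code sym_diff_in_code in \<open>auto simp: C'_def\<close>)
  moreover have "card (V - A) = n - q * (r + 1)"
    using h fin by (simp add: card_Diff_subset)
  moreover have "card C \<le> 2 ^ (q * r) * card C'"
    using card_code_le_shortened[of "A - J" A] det fin cAJ by (simp add: C'_def)
  moreover have "\<exists>p\<subseteq>V - A. i \<in> p \<and> linear_code.eqv C' p {} \<and> card p \<le> r + 1" if i: "i \<in> V - A" for i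
  proof -
    have "i \<in> V" using i by simp
    from rec[OF this]
    obtain R where R: "R \<subseteq> V" "i \<in> R" "card R = r + 1" "\<forall>u\<in>C. u \<inter> (R - {i}) = {} \<longrightarrow> i \<notin> u"
      by metis
    have "\<exists>p\<subseteq>R. i \<in> p \<and> eqv p {}"
      by (rule dual_word_of_recovering_set[OF R(1,2)]) (use R(4) in simp)
    then obtain p where p: "p \<subseteq> R" "i \<in> p" "eqv p {}" by metis
    have "chi (p - A) u = chi {} u" if "u \<in> C'" for u
    proof -
      have "(p - A) \<inter> u = p \<inter> u" using that by (auto simp: C'_def)
      then show ?thesis using p(3) that by (simp add: chi_def eqv_def C'_def)
    qed
    then have "linear_code.eqv C' (p - A) {}"
      using linear_code.eqv_def[OF \<open>linear_code (V - A) C'\<close>] by blast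
    moreover have "card (p - A) \<le> r + 1"
    proof -
      have "finite R" using R(1) finite_V finite_subset by blast
      then show ?thesis using p(1) R(3) by (metis Diff_subset card_mono order_trans)
    qed
    ultimately show ?thesis using p R(1) i by (intro exI[of _ "p - A"]) auto
  qed
  ultimately show ?thesis by (intro exI[of _ "V - A"] exI[of _ C']) (auto simp: C'_def)
qed

section \<open>Size bounds at finite length\<close>

lemma log_card_le_positive_distance:
  assumes w: "w > 0" and dual: "\<And>i. i \<in> V \<Longrightarrow> \<exists>p\<subseteq>V. i \<in> p \<and> eqv p {} \<and> card p \<le> w"
    and \<tau>: "0 < \<tau>" "\<tau> \<le> 1/2" and a: "a > 0" "a + m < n" "real (a + m) \<le> \<tau> * real n"
    and dist: "\<And>u. u \<in> C \<Longrightarrow> u \<noteq> {} \<Longrightarrow> d \<le> real (card u)" and d: "d > 0"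
    and gap: "real n - 2 * d + 1 \<le> 2 * sqrt (real a * real (n - a - m)) * (1 - 1 / real (m + 1))"
  shows "log 2 (card C) \<le> log 2 (2 * d) + real n * (bin_entropy \<tau> - c_const w \<tau>)"
proof -
  define \<theta> where "\<theta> = \<tau> / (1 - \<tau>)"
  have \<theta>: "0 < \<theta>" "\<theta> \<le> 1" using \<tau> by (auto simp: \<theta>_def field_simps)
  define \<rho> where "\<rho> = sqrt (real a / real (n - a - m))"
  define lam where "lam = 2 * sqrt (real a * real (n - a - m)) * (1 - 1 / real (m + 1))"
  define \<phi> where "\<phi> k = (if a \<le> k \<and> k \<le> a + m
      then \<rho> ^ k * ((real k - real a + 1) * (real m + 1 - (real k - real a))) else 0)" for k
  have \<rho>: "\<rho> > 0" using a by (simp add: \<rho>_def)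
  define X where "X = (1 + \<theta>) ^ n * exp (- (real n * \<theta> ^ (w + 1) / (4 * real w ^ 2 * real (w + 1))))"
  have X: "X > 0" using \<theta> by (simp add: X_def)
  have "real (card C) * (lam - (real n - 2 * d)) * \<theta> ^ (a + m) \<le> 2 * d * X"
    unfolding X_def
  proof (rule code_size_bound[OF w dual])
    show "\<phi> k \<ge> 0" for k using \<rho> by (auto simp: \<phi>_def)
    show "\<phi> k = 0" if "k > a + m" for k using that by (auto simp: \<phi>_def)
    show "a \<le> n" "\<phi> a > 0" using a \<rho> by (auto simp: \<phi>_def)
    show "lam * \<phi> k \<le> real k * \<phi> (k - 1) + (real n - real k) * \<phi> (k + 1)" if "k \<le> n" for k
      unfolding lam_def \<phi>_def \<rho>_def by (rule window_eigenvector[OF a(1,2) that])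
    show "real n - 2 * d \<le> lam" using gap by (simp add: lam_def)
  qed (use dist d \<theta> in auto)
  moreover have "real (card C) * 1 * \<theta> ^ (a + m) \<le> real (card C) * (lam - (real n - 2 * d)) * \<theta> ^ (a + m)"
    using gap \<theta> by (intro mult_right_mono mult_left_mono) (auto simp: lam_def)
  ultimately have "real (card C) * \<theta> ^ (a + m) \<le> 2 * d * X" by simp
  then have le: "real (card C) \<le> 2 * d * (X / \<theta> ^ (a + m))" using \<theta> by (simp add: field_simps)
  have "card C > 0" using finite_code empty_in_code by (auto simp: card_gt_0_iff)
  then have "log 2 (card C) \<le> log 2 (2 * d * (X / \<theta> ^ (a + m)))"
    using le by (subst log_le_cancel_iff) auto
  also have "\<dots> = log 2 (2 * d) + log 2 (X / \<theta> ^ (a + m))"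
    using d X \<theta> by (subst log_mult) auto
  also have "log 2 (X / \<theta> ^ (a + m)) \<le> real n * (bin_entropy \<tau> - c_const w \<tau>)"
    unfolding X_def \<theta>_def using leader_exponent_le[OF \<tau> w, of "a + m" n] a(3) by simp
  finally show ?thesis by simp
qed

text \<open>Nonempty codewords have size at least 1, and the constant function on the cube is an
  eigenfunction with eigenvalue \<open>n\<close>; so the size bound applies with
  \<open>d = 1\<close>, \<open>t = n\<close> and \<open>\<theta> = 1\<close>.\<close>

lemma log_card_le:
  assumes w: "w > 0" and dual: "\<And>i. i \<in> V \<Longrightarrow> \<exists>p\<subseteq>V. i \<in> p \<and> eqv p {} \<and> card p \<le> w"
  shows "log 2 (card C) \<le> real n * (bin_entropy (1/2) - c_const w (1/2))"
proof -
  define X where "X = (1 + 1) ^ n * exp (- (real n * 1 ^ (w + 1) / (4 * real w ^ 2 * real (w + 1))))"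
  have "real (card C) * (real n - (real n - 2 * 1)) * 1 ^ n \<le> 2 * 1 * X"
    unfolding X_def
  proof (rule code_size_bound[OF w dual, where ?k0.0 = 0 and \<phi> = "\<lambda>k. if k \<le> n then 1 else 0"])
    show "real n * (if k \<le> n then 1 else 0) \<le> real k * (if k - 1 \<le> n then 1 else 0)
        + (real n - real k) * (if k + 1 \<le> n then 1 else 0)" if "k \<le> n" for k
      using that by (cases "k = n") auto
    show "1 \<le> real (card u)" if "u \<in> C" "u \<noteq> {}" for u
      using that finite_codeword[of u] by (simp add: Suc_le_eq card_gt_0_iff)
  qed auto
  then have le: "real (card C) \<le> X" by simp
  have "card C > 0" using finite_code empty_in_code by (auto simp: card_gt_0_iff)
  then have "log 2 (card C) \<le> log 2 X" using le by (subst log_le_cancel_iff) auto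
  also have "\<dots> \<le> real n * (bin_entropy (1/2) - c_const w (1/2))"
    using leader_exponent_le[OF _ _ w, of "1/2" n n] by (simp add: X_def)
  finally show ?thesis .
qed

end

section \<open>Transfer from words as Boolean functions to sets\<close>

text \<open>Words become their supports via \<open>Collect\<close>. A codeword vanishing on
  \<open>R - {i}\<close> agrees there with the zero word, so \<open>\<phi>\<close> gives both the
  same value at \<open>i\<close>, namely \<open>False\<close>.\<close>

lemma shortened_LRC:
  assumes lin: "binary_linear_code n K" and md: "min_dist_ge K d" and loc: "has_locality n r K"
    and q: "q * (r + 1) \<le> n"
  shows "\<exists>(V :: nat set) C. linear_code V C \<and> card V = n - q * (r + 1) \<and> card K \<le> 2 ^ (q * r) * card C \<and>
    (\<forall>i\<in>V. \<exists>p\<subseteq>V. i \<in> p \<and> linear_code.eqv C p {} \<and> card p \<le> r + 1) \<and>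
    (\<forall>u\<in>C. u \<noteq> {} \<longrightarrow> d \<le> real (card u))"
proof -
  define C where "C = Collect ` K"
  have zero: "(\<lambda>_. False) \<in> K" using lin by (simp add: binary_linear_code_def)
  interpret linear_code "{..<n}" C
  proof
    show "C \<subseteq> Pow {..<n}"
      using lin unfolding C_def binary_linear_code_def words_def by (auto simp: subset_iff) (meson not_le)
    show "{} \<in> C" unfolding C_def by (rule image_eqI[OF _ zero]) simp
    show "sym_diff u v \<in> C" if uv: "u \<in> C" "v \<in> C" for u v
    proof -
      obtain c c' where c: "c \<in> K" "c' \<in> K" "u = Collect c" "v = Collect c'" using uv by (auto simp: C_def)
      have "(\<lambda>j. c j \<noteq> c' j) \<in> K" using lin c by (simp add: binary_linear_code_def)
      moreover have "sym_diff u v = Collect (\<lambda>j. c j \<noteq> c' j)" using c by auto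
      ultimately show ?thesis unfolding C_def by blast
    qed
  qed simp
  have rec: "\<exists>R\<subseteq>{..<n}. i \<in> R \<and> card R = r + 1 \<and> (\<forall>u\<in>C. u \<inter> (R - {i}) = {} \<longrightarrow> i \<notin> u)"
    if i: "i \<in> {..<n}" for i
  proof -
    obtain R \<phi> where R: "R \<subseteq> {0..<n}" "i \<in> R" "card R = r + 1"
      and \<phi>: "\<And>c. c \<in> K \<Longrightarrow> c i = \<phi> (map c (sorted_list_of_set (R - {i})))"
      using loc i unfolding has_locality_def by (metis lessThan_iff)
    have "i \<notin> Collect c" if c: "c \<in> K" "Collect c \<inter> (R - {i}) = {}" for c
    proof -
      have "finite (R - {i})" using R(1) finite_subset by blast
      then have eq: "map c (sorted_list_of_set (R - {i})) = map (\<lambda>_. False) (sorted_list_of_set (R - {i}))"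
        using c(2) by (intro map_cong) auto
      have "c i = False" unfolding \<phi>[OF c(1)] eq by (rule \<phi>[OF zero, symmetric])
      then show ?thesis by simp
    qed
    then show ?thesis using R by (intro exI[of _ R]) (auto simp: C_def)
  qed
  have "card C = card K" unfolding C_def by (intro card_image inj_onI) (simp add: fun_eq_iff set_eq_iff)
  obtain V' C' where h: "linear_code V' C'" "C' \<subseteq> C" "card V' = n - q * (r + 1)" "card C \<le> 2 ^ (q * r) * card C'"
     "\<forall>i\<in>V'. \<exists>p\<subseteq>V'. i \<in> p \<and> linear_code.eqv C' p {} \<and> card p \<le> r + 1"
    using shortening[OF rec, of q] q by auto
  have "d \<le> real (card u)" if u: "u \<in> C'" "u \<noteq> {}" for u
  proof -
    obtain c where c: "c \<in> K" "u = Collect c" using u h(2) by (auto simp: C_def)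
    have "c \<noteq> (\<lambda>_. False)" using c u by auto
    then have "d \<le> real (hamming_dist c (\<lambda>_. False))" using md c(1) zero by (auto simp: min_dist_ge_def)
    then show ?thesis using c(2) by (simp add: hamming_dist_def)
  qed
  then show ?thesis using h \<open>card C = card K\<close> by (intro exI[of _ V'] exI[of _ C']) auto
qed

section \<open>Asymptotics\<close>

lemma finite_words: "finite (words n)"
proof (rule finite_imageD)
  have "Collect ` words n \<subseteq> Pow {..<n}" by (auto simp: words_def not_le[symmetric])
  then show "finite (Collect ` words n)" by (rule finite_subset) simp
  show "inj_on Collect (words n)" by (intro inj_onI) (simp add: fun_eq_iff set_eq_iff)
qed

text \<open>The maximum is over a finite set, which contains the size of the zero code;
  \<open>r + 1 \<le> n\<close> provides recovering sets for it.\<close>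

lemma M_lin_attained:
  assumes n: "r + 1 \<le> n"
  shows "\<exists>K. binary_linear_code n K \<and> min_dist_ge K d \<and> has_locality n r K \<and> M_lin n r d = card K"
proof -
  let ?S = "{card C | C. binary_linear_code n C \<and> min_dist_ge C d \<and> has_locality n r C}"
  have "?S \<subseteq> card ` Pow (words n)" by (auto simp: binary_linear_code_def)
  then have "finite ?S" by (rule finite_subset) (simp add: finite_words)
  moreover have "card {\<lambda>_ :: nat. False} \<in> ?S"
  proof -
    let ?Z = "{\<lambda>_ :: nat. False}"
    have "has_locality n r ?Z"
      unfolding has_locality_def
    proof (intro allI impI)
      fix i assume "i < n"
      then obtain R where "{i} \<subseteq> R" "R \<subseteq> {0..<n}" "card R = r + 1"
        using exists_subset_between[of "{i}" "r + 1" "{0..<n}"] n by auto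
      then show "\<exists>R (\<phi> :: bool list \<Rightarrow> bool). R \<subseteq> {0..<n} \<and> i \<in> R \<and> card R = r + 1 \<and>
          (\<forall>c\<in>?Z. c i = \<phi> (map c (sorted_list_of_set (R - {i}))))"
        by (intro exI[of _ R] exI[of _ "\<lambda>_. False"]) auto
    qed
    moreover have "binary_linear_code n ?Z" by (simp add: binary_linear_code_def words_def)
    moreover have "min_dist_ge ?Z d" by (simp add: min_dist_ge_def)
    ultimately show ?thesis by blast
  qed
  ultimately have "Max ?S \<in> ?S" by (intro Max_in) auto
  then show ?thesis unfolding M_lin_def by auto
qed

text \<open>First \<open>m\<close> is fixed with \<open>1 - 1 / (m + 1)\<close> close enough to 1,
  then \<open>a + m\<close> is the integer part of \<open>\<tau> * N\<close>; after division by
  \<open>N\<close> the shift \<open>m\<close> and the constant \<open>B\<close> vanish in the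
  limit.\<close>

lemma eventually_window_gap:
  fixes \<tau> \<eta> B :: real
  assumes \<tau>: "0 < \<tau>" "\<tau> < 1/2" and \<eta>: "\<eta> < 2 * sqrt (\<tau> * (1 - \<tau>))"
  shows "\<exists>m. \<forall>\<^sub>F N in sequentially. \<exists>a>0. a + m < N \<and> real (a + m) \<le> \<tau> * real N \<and>
    \<eta> * real N + B \<le> 2 * sqrt (real a * real (N - a - m)) * (1 - 1 / real (m + 1))"
proof -
  define \<sigma> where "\<sigma> = sqrt (\<tau> * (1 - \<tau>))"
  have "(\<lambda>m. 2 * \<sigma> * (1 - 1 / real (m + 1))) \<longlonglongrightarrow> 2 * \<sigma> * (1 - 0)"
    by (intro tendsto_intros LIMSEQ_ignore_initial_segment[OF lim_1_over_n])
  then have "\<forall>\<^sub>F m in sequentially. \<eta> < 2 * \<sigma> * (1 - 1 / real (m + 1))"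
    using \<eta> by (intro order_tendstoD) (auto simp: \<sigma>_def)
  then obtain m where m: "\<eta> < 2 * \<sigma> * (1 - 1 / real (m + 1))"
    by (meson eventually_happens' sequentially_bot)
  define e where "e = 1 - 1 / real (m + 1)"
  have e: "e \<ge> 0" by (simp add: e_def)
  have inv: "(\<lambda>N. x / real N) \<longlonglongrightarrow> 0" for x
    by (rule tendsto_divide_0[OF tendsto_const filterlim_at_top_imp_at_infinity[OF filterlim_real_sequentially]])
  have "(\<lambda>N. 2 * sqrt ((\<tau> - real (m + 1) / real N) * (1 - \<tau>)) * e - (\<eta> + B / real N))
      \<longlonglongrightarrow> 2 * sqrt ((\<tau> - 0) * (1 - \<tau>)) * e - (\<eta> + 0)"
    by (intro tendsto_intros inv)
  then have "\<forall>\<^sub>F N in sequentially. 0 < 2 * sqrt ((\<tau> - real (m + 1) / real N) * (1 - \<tau>)) * e - (\<eta> + B / real N)"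
    using m by (intro order_tendstoD) (auto simp: \<sigma>_def e_def)
  moreover have "\<forall>\<^sub>F N in sequentially. real (m + 1) / \<tau> < real N"
    using filterlim_real_sequentially by (rule filterlim_at_top_dense[THEN iffD1, rule_format])
  ultimately have "\<forall>\<^sub>F N in sequentially. \<exists>a>0. a + m < N \<and> real (a + m) \<le> \<tau> * real N \<and>
    \<eta> * real N + B \<le> 2 * sqrt (real a * real (N - a - m)) * (1 - 1 / real (m + 1))"
  proof eventually_elim
    case (elim N)
    have N: "real (m + 1) < \<tau> * real N" using elim(2) \<tau> by (simp add: field_simps)
    then have "0 < \<tau> * real N" by (meson less_trans of_nat_0_less_iff zero_less_Suc add_gr_0 zero_less_one)
    then have N0: "real N > 0" using \<tau> by (simp add: zero_less_mult_iff)
    define a where "a = nat \<lfloor>\<tau> * real N\<rfloor> - m"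
    have fl: "m + 1 \<le> nat \<lfloor>\<tau> * real N\<rfloor>" using N by (simp add: le_nat_floor less_imp_le)
    have fl1: "real (nat \<lfloor>\<tau> * real N\<rfloor>) \<le> \<tau> * real N" "\<tau> * real N - 1 \<le> real (nat \<lfloor>\<tau> * real N\<rfloor>)"
      using \<open>0 < \<tau> * real N\<close> by linarith+
    have am: "a + m = nat \<lfloor>\<tau> * real N\<rfloor>" "a > 0" using fl by (auto simp: a_def)
    have le: "real (a + m) \<le> \<tau> * real N" using am fl1 by simp
    have "\<tau> * real N < 1 * real N" using \<tau> N0 by (intro mult_strict_right_mono) auto
    then have lt: "a + m < N" using le by simp
    \<comment> \<open>Rounding loses at most 1 and the window \<open>m\<close>, whence
      \<open>m + 1\<close>.\<close>
    have a_ge: "real N * (\<tau> - real (m + 1) / real N) \<le> real a"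
    proof -
      have "real a + real m = real (nat \<lfloor>\<tau> * real N\<rfloor>)" using am(1) by (simp flip: of_nat_add)
      moreover have "real N * (\<tau> - real (m + 1) / real N) = \<tau> * real N - real (m + 1)"
        using N0 by (simp add: right_diff_distrib)
      ultimately show ?thesis using fl1(2) by simp
    qed
    have b_ge: "real N * (1 - \<tau>) \<le> real (N - a - m)"
      using le lt by (simp add: of_nat_diff algebra_simps)
    have "\<eta> * real N + B = real N * (\<eta> + B / real N)" using N0 by (simp add: field_simps)
    also have "\<dots> \<le> real N * (2 * sqrt ((\<tau> - real (m + 1) / real N) * (1 - \<tau>)) * e)"
      using elim(1) by (intro mult_left_mono) auto
    also have "\<dots> = 2 * sqrt ((real N * (\<tau> - real (m + 1) / real N)) * (real N * (1 - \<tau>))) * e"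
    proof -
      have "(real N * (\<tau> - real (m + 1) / real N)) * (real N * (1 - \<tau>)) =
          (real N)\<^sup>2 * ((\<tau> - real (m + 1) / real N) * (1 - \<tau>))"
        by (simp add: power2_eq_square)
      then show ?thesis by (simp add: real_sqrt_mult)
    qed
    also have "\<dots> \<le> 2 * sqrt (real a * real (N - a - m)) * e"
      using a_ge b_ge e \<tau> by (intro mult_right_mono mult_left_mono real_sqrt_le_mono mult_mono) auto
    finally show ?case using am(2) lt le by (intro exI[of _ a]) (simp add: e_def)
  qed
  then show ?thesis by blast
qed

text \<open>Shortening with \<open>q\<close> close to \<open>s * n\<close> leaves length about
  \<open>\<kappa> * n\<close> and distance \<open>\<delta> * n\<close>, hence relative distance
  \<open>\<delta> / \<kappa>\<close>. The strict inequality for \<open>\<tau>\<close> leaves room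
  for rounding and for a spectral gap of 1.\<close>

lemma R_lin_le:
  fixes r :: nat and \<delta> s \<tau> :: real
  defines "\<kappa> \<equiv> 1 - s * real (r + 1)"
    and "\<rho> \<equiv> bin_entropy \<tau> - c_const (r + 1) \<tau>"
  assumes \<delta>: "0 \<le> \<delta>" "\<delta> \<le> 1/2" and s: "0 \<le> s" "s < 1 / real (r + 1)"
    and \<tau>: "\<delta> = 0 \<and> \<tau> = 1/2 \<or> \<delta> > 0 \<and> 0 < \<tau> \<and> \<tau> < 1/2 \<and> 1 - 2 * (\<delta> / \<kappa>) < 2 * sqrt (\<tau> * (1 - \<tau>))"
  shows "R_lin r \<delta> \<le> ereal (s * real r + \<kappa> * \<rho>)"
proof -
  have \<kappa>: "\<kappa> > 0" using s by (simp add: \<kappa>_def field_simps)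
  define \<eta> where "\<eta> = 1 - 2 * (\<delta> / \<kappa>)"
  \<comment> \<open>\<open>B\<close> absorbs the rounding of \<open>q\<close>, which lets
    \<open>N\<close> exceed \<open>\<kappa> * n\<close> by up to \<open>r + 1\<close>, and the
    required gap of 1.\<close>
  define B where "B = 2 * (\<delta> / \<kappa>) * real (r + 1) + 1"
  define b where "b n = s * real r + \<kappa> * \<rho> + (ln (real n) / real n) / ln 2 + real (r + 1) * \<bar>\<rho>\<bar> / real n" for n
  obtain m N0 where gap: "\<delta> > 0 \<Longrightarrow> N \<ge> N0 \<Longrightarrow> \<exists>a>0. a + m < N \<and> real (a + m) \<le> \<tau> * real N \<and>
    \<eta> * real N + B \<le> 2 * sqrt (real a * real (N - a - m)) * (1 - 1 / real (m + 1))" for N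
  proof (cases "\<delta> > 0")
    case True
    then have "0 < \<tau>" "\<tau> < 1/2" "\<eta> < 2 * sqrt (\<tau> * (1 - \<tau>))" using \<tau> by (auto simp: \<eta>_def)
    from eventually_window_gap[OF this, of B] obtain m where
      "\<forall>\<^sub>F N in sequentially. \<exists>a>0. a + m < N \<and> real (a + m) \<le> \<tau> * real N \<and>
      \<eta> * real N + B \<le> 2 * sqrt (real a * real (N - a - m)) * (1 - 1 / real (m + 1))" by blast
    then show ?thesis using that unfolding eventually_sequentially by blast
  qed (use that in blast)
  have "\<forall>\<^sub>F n in sequentially. real N0 / \<kappa> \<le> real n"
    using filterlim_real_sequentially by (rule filterlim_at_top[THEN iffD1, rule_format])
  then have "\<forall>\<^sub>F n in sequentially. log 2 (real (M_lin n r (\<delta> * real n))) / real n \<le> b n"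
    using eventually_ge_at_top[of "r + 1"]
  proof eventually_elim
    case (elim n)
    have n: "real n > 0" "real n \<ge> 1" using elim(2) by auto
    define q where "q = nat \<lfloor>s * real n\<rfloor>"
    have q: "real q \<le> s * real n" "s * real n - 1 \<le> real q"
      unfolding q_def using mult_nonneg_nonneg[OF s(1), of "real n"] by linarith+
    have "real (q * (r + 1)) \<le> s * real n * real (r + 1)"
      using q(1) by (simp only: of_nat_mult) (intro mult_right_mono, auto)
    also have "\<dots> = real n - \<kappa> * real n" by (simp add: \<kappa>_def algebra_simps)
    finally have qn: "real (q * (r + 1)) \<le> real n - \<kappa> * real n" .
    then have "real (q * (r + 1)) \<le> real n" using \<kappa> n mult_pos_pos[OF \<kappa> n(1)] by linarith
    then have qle: "q * (r + 1) \<le> n" by (simp only: of_nat_le_iff)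
    define N where "N = n - q * (r + 1)"
    have realN: "real N = real n - real (q * (r + 1))" using qle by (simp add: N_def of_nat_diff)
    have N_lo: "\<kappa> * real n \<le> real N" using qn realN by simp
    have "(s * real n - 1) * real (r + 1) \<le> real q * real (r + 1)"
      using q(2) by (intro mult_right_mono) auto
    then have N_hi: "real N \<le> \<kappa> * real n + real (r + 1)"
      unfolding realN \<kappa>_def by (simp add: algebra_simps)
    obtain K where K: "binary_linear_code n K" "min_dist_ge K (\<delta> * real n)" "has_locality n r K"
        "M_lin n r (\<delta> * real n) = card K"
      using M_lin_attained[OF elim(2)] by blast
    obtain V :: "nat set" and C where C: "linear_code V C" "card V = N" "card K \<le> 2 ^ (q * r) * card C"
      and dual: "\<And>i. i \<in> V \<Longrightarrow> \<exists>p\<subseteq>V. i \<in> p \<and> linear_code.eqv C p {} \<and> card p \<le> r + 1"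
      and dist: "\<And>u. u \<in> C \<Longrightarrow> u \<noteq> {} \<Longrightarrow> \<delta> * real n \<le> real (card u)"
      using shortened_LRC[OF K(1-3) qle] unfolding N_def by metis
    interpret linear_code V C by (rule C(1))
    have "card C > 0" using finite_code empty_in_code by (auto simp: card_gt_0_iff)
    have "K \<subseteq> words n" "(\<lambda>_. False) \<in> K" using K(1) by (auto simp: binary_linear_code_def)
    then have "card K > 0" using finite_words finite_subset by (metis card_gt_0_iff empty_iff)
    have log_C: "log 2 (card C) \<le> log 2 (real n) + real N * \<rho>"
    proof (cases "\<delta> > 0")
      case False
      then have "\<tau> = 1/2" using \<tau> by auto
      then have "log 2 (card C) \<le> real N * \<rho>"
        using log_card_le[OF _ dual] unfolding \<rho>_def \<open>\<tau> = 1/2\<close> C(2) by simp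
      moreover have "0 \<le> log 2 (real n)" using n by simp
      ultimately show ?thesis by simp
    next
      case True
      have "real N0 \<le> \<kappa> * real n" using elim(1) \<kappa> by (simp add: field_simps)
      then have "N0 \<le> N" using N_lo by simp
      from gap[OF True this] obtain a where a: "a > 0" "a + m < N" "real (a + m) \<le> \<tau> * real N"
        and g: "\<eta> * real N + B \<le> 2 * sqrt (real a * real (N - a - m)) * (1 - 1 / real (m + 1))" by blast
      have "\<delta> / \<kappa> * (real N - real (r + 1)) \<le> \<delta> / \<kappa> * (\<kappa> * real n)"
        using N_hi \<delta> \<kappa> by (intro mult_left_mono) auto
      also have "\<dots> = \<delta> * real n" using \<kappa> by simp
      finally have "\<delta> / \<kappa> * (real N - real (r + 1)) \<le> \<delta> * real n" .
      moreover have "real N - 2 * (\<delta> * real n) + 1 \<le> (1 - 2 * x) * real N + (2 * x * real (r + 1) + 1)"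
        if "x * (real N - real (r + 1)) \<le> \<delta> * real n" for x
        using that by (simp add: algebra_simps)
      ultimately have "real N - 2 * (\<delta> * real n) + 1 \<le> \<eta> * real N + B"
        unfolding \<eta>_def B_def by blast
      also note g
      finally have g': "real N - 2 * (\<delta> * real n) + 1 \<le> 2 * sqrt (real a * real (N - a - m)) * (1 - 1 / real (m + 1))" .
      have "log 2 (card C) \<le> log 2 (2 * (\<delta> * real n)) + real N * \<rho>"
        unfolding \<rho>_def C(2)[symmetric]
      proof (rule log_card_le_positive_distance[OF _ dual])
        show "real (card V) - 2 * (\<delta> * real n) + 1
          \<le> 2 * sqrt (real a * real (card V - a - m)) * (1 - 1 / real (m + 1))"
          using g' C(2) by simp
      qed (use a True \<tau> n dist C(2) in auto)
      also have "log 2 (2 * (\<delta> * real n)) \<le> log 2 (real n)"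
      proof -
        have "2 * (\<delta> * real n) \<le> real n" using mult_right_mono[OF \<delta>(2), of "real n"] by simp
        then show ?thesis using True n by (subst log_le_cancel_iff) auto
      qed
      finally show ?thesis by simp
    qed
    have "log 2 (real (card K)) \<le> log 2 (2 ^ (q * r) * real (card C))"
    proof -
      have "real (card K) \<le> real (2 ^ (q * r) * card C)" using C(3) by (simp only: of_nat_le_iff)
      then show ?thesis using \<open>card K > 0\<close> \<open>card C > 0\<close> by (subst log_le_cancel_iff) auto
    qed
    also have "\<dots> = real q * real r + log 2 (card C)"
      using \<open>card C > 0\<close> by (simp add: log_mult log_nat_power)
    also have "\<dots> \<le> s * real n * real r + (log 2 (real n) + real N * \<rho>)"
      using q(1) log_C by (intro add_mono mult_right_mono) auto
    \<comment> \<open>The absolute value covers both signs of \<open>\<rho>\<close>.\<close>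
    also have "real N * \<rho> \<le> \<kappa> * real n * \<rho> + real (r + 1) * \<bar>\<rho>\<bar>"
    proof -
      have "(real N - \<kappa> * real n) * \<rho> \<le> (real N - \<kappa> * real n) * \<bar>\<rho>\<bar>"
        using N_lo by (intro mult_left_mono) auto
      also have "\<dots> \<le> real (r + 1) * \<bar>\<rho>\<bar>" using N_hi by (intro mult_right_mono) auto
      finally show ?thesis by (simp add: algebra_simps)
    qed
    finally have "log 2 (real (card K)) \<le>
        s * real n * real r + (log 2 (real n) + (\<kappa> * real n * \<rho> + real (r + 1) * \<bar>\<rho>\<bar>))" by simp
    also have "\<dots> = real n * b n"
    proof -
      have "s * real n * real r + (L / ln 2 + (\<kappa> * real n * \<rho> + D)) =
          real n * (s * real r + \<kappa> * \<rho> + (L / real n) / ln 2 + D / real n)" for L D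
        using n by (simp add: field_simps)
      then show ?thesis by (simp only: b_def log_def)
    qed
    finally have "log 2 (real (card K)) \<le> real n * b n" .
    then show ?case using n K(4) by (simp add: field_simps)
  qed
  then have "R_lin r \<delta> \<le> limsup (\<lambda>n. ereal (b n))"
    unfolding R_lin_def by (intro Limsup_mono) (auto elim: eventually_mono)
  also have "\<dots> = ereal (s * real r + \<kappa> * \<rho>)"
  proof (rule lim_imp_Limsup)
    have "(\<lambda>n. ln (real n) / real n) \<longlonglongrightarrow> 0"
      using filterlim_compose[OF ln_x_over_x_tendsto_0 filterlim_real_sequentially] .
    moreover have "(\<lambda>n. real (r + 1) * \<bar>\<rho>\<bar> / real n) \<longlonglongrightarrow> 0"
      by (rule tendsto_divide_0[OF tendsto_const filterlim_at_top_imp_at_infinity[OF filterlim_real_sequentially]])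
    ultimately have "b \<longlonglongrightarrow> s * real r + \<kappa> * \<rho> + 0 / ln 2 + 0"
      unfolding b_def by (intro tendsto_add tendsto_divide tendsto_const) auto
    then show "(\<lambda>n. ereal (b n)) \<longlonglongrightarrow> ereal (s * real r + \<kappa> * \<rho>)" by simp
  qed simp
  finally show ?thesis .
qed

section \<open>Continuity of the entropy and the final bound\<close>

text \<open>Substituting 1/x turns \<open>x * ln x\<close> at 0 into \<open>- (ln x / x)\<close> at
  infinity. The endpoint 0 is reached when the relative distance after shortening is 1/2.\<close>

lemma tendsto_bin_entropy_at_right_0: "(bin_entropy \<longlongrightarrow> bin_entropy 0) (at_right 0)"
proof -
  have "((\<lambda>x::real. - (ln x / x)) \<longlongrightarrow> - 0) at_top"
    by (intro tendsto_minus ln_x_over_x_tendsto_0)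
  moreover have "\<forall>\<^sub>F x :: real in at_top. - (ln x / x) = inverse x * ln (inverse x)"
    unfolding ln_inverse by (simp add: divide_inverse)
  ultimately have "((\<lambda>x::real. inverse x * ln (inverse x)) \<longlongrightarrow> 0) at_top"
    by (simp cong: filterlim_cong)
  then have xlnx: "((\<lambda>x::real. x * ln x) \<longlongrightarrow> 0) (at_right 0)"
    by (simp add: filterlim_at_right_to_top)
  have "((\<lambda>x::real. - (x * ln x / ln 2) - (1 - x) * (ln (1 - x) / ln 2)) \<longlongrightarrow>
      - (0 / ln 2) - (1 - 0) * (ln (1 - 0) / ln 2)) (at_right 0)"
    by (intro tendsto_intros xlnx) auto
  then show ?thesis by (simp add: bin_entropy_def [abs_def] log_def)
qed

lemma tendsto_bin_entropy:
  assumes "0 < x" "x < 1"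
  shows "(bin_entropy \<longlongrightarrow> bin_entropy x) (at x within S)"
proof -
  have "isCont bin_entropy x"
    unfolding bin_entropy_def [abs_def] log_def using assms by (intro continuous_intros) auto
  then show ?thesis
    using continuous_at_imp_continuous_at_within continuous_within by blast
qed

text \<open>The bound for every \<open>s\<close> expresses the minimum. For positive
  \<open>\<delta>\<close>, \<open>R_lin_le\<close> is applied to \<open>\<tau>\<close> near the
  value in \<open>R0\<close>, and continuity of the entropy gives the bound in the limit.\<close>

theorem theorem6:
  fixes r :: nat and \<delta> :: real
  assumes "r \<ge> 1" and "0 \<le> \<delta>" and "\<delta> \<le> 1/2"
  shows "\<forall>s. 0 \<le> s \<and> s < 1 / real (r + 1) \<and> \<delta> / (1 - s * real (r + 1)) \<le> 1 \<longrightarrow>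
           R_lin r \<delta> \<le> ereal (s * real r + (1 - s * real (r + 1)) * R0 r (\<delta> / (1 - s * real (r + 1))))"
proof (intro allI impI)
  fix s :: real
  assume s: "0 \<le> s \<and> s < 1 / real (r + 1) \<and> \<delta> / (1 - s * real (r + 1)) \<le> 1"
  define \<kappa> where "\<kappa> = 1 - s * real (r + 1)"
  define \<delta>' where "\<delta>' = \<delta> / \<kappa>"
  define \<tau>0 where "\<tau>0 = 1/2 - sqrt (\<delta>' * (1 - \<delta>'))"
  define F where "F \<tau> = s * real r + \<kappa> * (bin_entropy \<tau> - c_const (r + 1) \<tau>)" for \<tau>
  have \<kappa>: "\<kappa> > 0" using s by (simp add: \<kappa>_def field_simps)
  have \<delta>': "0 \<le> \<delta>'" "\<delta>' \<le> 1" using assms s \<kappa> by (auto simp: \<delta>'_def \<kappa>_def)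
  have cont: "(F \<longlongrightarrow> F \<tau>0) G" if "(bin_entropy \<longlongrightarrow> bin_entropy \<tau>0) G" "((\<lambda>x. x) \<longlongrightarrow> \<tau>0) G" for G
    unfolding F_def [abs_def] c_const_def [abs_def] by (intro tendsto_intros that) auto
  have bound: "R_lin r \<delta> \<le> ereal (F \<tau>)"
    if "\<delta> > 0" "0 < \<tau>" "\<tau> < 1/2" "1 - 2 * \<delta>' < 2 * sqrt (\<tau> * (1 - \<tau>))" for \<tau>
    unfolding F_def \<kappa>_def by (rule R_lin_le) (use assms s that in \<open>auto simp: \<delta>'_def \<kappa>_def\<close>)
  \<comment> \<open>For \<open>\<delta>' \<le> 1/2\<close> this says that \<open>\<tau>0\<close> is
    the point of equality in the spectral condition.\<close>
  have sq: "\<tau>0 * (1 - \<tau>0) = (1/2 - \<delta>')\<^sup>2"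
  proof -
    have "\<tau>0 * (1 - \<tau>0) = 1/4 - (sqrt (\<delta>' * (1 - \<delta>')))\<^sup>2"
      by (simp add: \<tau>0_def power2_eq_square algebra_simps)
    also have "\<dots> = 1/4 - \<delta>' * (1 - \<delta>')" using \<delta>' by simp
    finally show ?thesis by (simp add: power2_eq_square algebra_simps)
  qed
  have \<tau>0: "0 \<le> \<tau>0" "\<tau>0 \<le> 1/2"
  proof -
    have "\<delta>' * (1 - \<delta>') \<le> (1/2)\<^sup>2"
      using zero_le_power2[of "1/2 - \<delta>'"] by (simp add: power2_eq_square algebra_simps)
    then have "sqrt (\<delta>' * (1 - \<delta>')) \<le> 1/2" by (rule real_le_lsqrt[rotated]) simp
    then show "0 \<le> \<tau>0" by (simp add: \<tau>0_def)
    show "\<tau>0 \<le> 1/2" using \<delta>' by (simp add: \<tau>0_def)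
  qed
  have "R_lin r \<delta> \<le> ereal (F \<tau>0)"
  proof -
    consider "\<delta> = 0" | "\<delta> > 0" "\<delta>' \<le> 1/2" | "\<delta> > 0" "\<delta>' > 1/2" using assms by linarith
    then show ?thesis
    proof cases
      case 1
      then have "\<tau>0 = 1/2" by (simp add: \<tau>0_def \<delta>'_def)
      then show ?thesis
        unfolding F_def \<kappa>_def using assms s 1 by (intro R_lin_le) auto
    next
      case 2
      then have "\<delta>' > 0" using \<kappa> by (simp add: \<delta>'_def)
      then have "\<tau>0 < 1/2" using 2 by (simp add: \<tau>0_def)
      have ent: "(bin_entropy \<longlongrightarrow> bin_entropy \<tau>0) (at_right \<tau>0)"
      proof (cases "\<tau>0 = 0")
        case True
        then show ?thesis using tendsto_bin_entropy_at_right_0 by simp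
      next
        case False
        then show ?thesis
          using \<tau>0 by (intro tendsto_bin_entropy) auto
      qed
      have "\<forall>\<^sub>F \<tau> in at_right \<tau>0. R_lin r \<delta> \<le> ereal (F \<tau>)"
        using eventually_at_right_less[of \<tau>0] eventually_at_right_real[OF \<open>\<tau>0 < 1/2\<close>]
      proof eventually_elim
        case (elim \<tau>)
        have "(1/2 - \<delta>')\<^sup>2 < \<tau> * (1 - \<tau>)"
        proof -
          \<comment> \<open>The product is the difference of \<open>x * (1 - x)\<close> at
            \<open>\<tau>\<close> and at \<open>\<tau>0\<close>, so every \<open>\<tau>\<close>
            between \<open>\<tau>0\<close> and 1/2 is admissible.\<close>
          have "0 < (\<tau> - \<tau>0) * (1 - \<tau> - \<tau>0)" using elim \<tau>0 by (intro mult_pos_pos) auto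
          then show ?thesis unfolding sq[symmetric] by (simp add: algebra_simps)
        qed
        then have "1/2 - \<delta>' < sqrt (\<tau> * (1 - \<tau>))" by (rule real_less_rsqrt)
        then show ?case using 2 elim \<tau>0 by (intro bound) auto
      qed
      moreover have "((\<lambda>\<tau>. ereal (F \<tau>)) \<longlongrightarrow> ereal (F \<tau>0)) (at_right \<tau>0)"
        using cont[OF ent] by (simp add: tendsto_ident_at)
      ultimately show ?thesis
        by (intro tendsto_lowerbound[where F = "at_right \<tau>0"]) auto
    next
      case 3
      then have "\<tau>0 > 0"
      proof -
        have "0 < (1/2 - \<delta>')\<^sup>2" using 3 by simp
        then show ?thesis using sq \<tau>0 by (metis less_eq_real_def mult_zero_left)
      qed
      have ent: "(bin_entropy \<longlongrightarrow> bin_entropy \<tau>0) (at_left \<tau>0)"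
        using \<tau>0 \<open>\<tau>0 > 0\<close> by (intro tendsto_bin_entropy) auto
      have "\<forall>\<^sub>F \<tau> in at_left \<tau>0. R_lin r \<delta> \<le> ereal (F \<tau>)"
        using eventually_at_left_real[OF \<open>\<tau>0 > 0\<close>]
      proof eventually_elim
        case (elim \<tau>)
        then have "0 < \<tau>" "\<tau> < 1/2" using \<tau>0 by auto
        \<comment> \<open>Every \<open>\<tau>\<close> between 0 and 1/2 is now admissible; the limit
          from the left stays below 1/2 even if \<open>\<tau>0 = 1/2\<close>.\<close>
        moreover have "1 - 2 * \<delta>' < 0" using 3 by simp
        moreover have "0 \<le> 2 * sqrt (\<tau> * (1 - \<tau>))" using \<open>0 < \<tau>\<close> \<open>\<tau> < 1/2\<close> by simp
        ultimately show ?case using 3 by (intro bound) linarith+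
      qed
      moreover have "((\<lambda>\<tau>. ereal (F \<tau>)) \<longlongrightarrow> ereal (F \<tau>0)) (at_left \<tau>0)"
        using cont[OF ent] by (simp add: tendsto_ident_at)
      ultimately show ?thesis
        by (intro tendsto_lowerbound[where F = "at_left \<tau>0"]) auto
    qed
  qed
  moreover have "R0 r (\<delta> / (1 - s * real (r + 1))) = bin_entropy \<tau>0 - c_const (r + 1) \<tau>0"
    by (simp add: R0_def Let_def \<tau>0_def \<delta>'_def \<kappa>_def)
  ultimately show "R_lin r \<delta> \<le> ereal (s * real r + (1 - s * real (r + 1)) * R0 r (\<delta> / (1 - s * real (r + 1))))"
    by (simp add: F_def \<kappa>_def)
qed

end
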